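(* Let $n\ge 0$ and $R_n=\mathbb{Q}[x_1,\dots,x_n]$. Then $R_n/\langle\mathrm{QSym}_n^{+}\rangle\cong R_n/\mathbf{I}(\mathrm{QSV}_n)$ as $\mathbb{Q}$-vector spaces.
   Context: A composition is a sequence of positive integers $\alpha=(\alpha_1,\dots,\alpha_k)$; its length is $\ell(\alpha)=k$. For a non-empty composition $\alpha$ of length $k$, $M_\alpha=\sum_{1\le i_1<\cdots<i_k\le n}x_{i_1}^{\alpha_1}\cdots x_{i_k}^{\alpha_k}\in R_n$. The positive-degree quasisymmetric polynomials $\mathrm{QSym}_n^{+}$ are the $\mathbb{Q}$-span of the $M_\alpha$ with $\alpha$ non-empty and $\ell(\alpha)\le n$; $\langle\mathrm{QSym}_n^{+}\rangle$ is the ideal they generate in $R_n$. A noncrossing partition of size $n$ is a set $\lambda$ of arcs $(i,j)$, $1\le i<j\le n$, such that there are no two distinct arcs $(i,k),(j,l)\in\lambda$ with $i\le j<k\le l$. The connected components of $\lambda$ are those of the graph on $[n]=\{1,\dots,n\}$ whose edges are the arcs. The permutation $Q_\lambda\in S_n$ is defined by $Q_\lambda(j)=i$ if there is an arc $(i,j)\in\lambda$ with right endpoint $j$, and otherwise $Q_\lambda(j)$ is the largest element of the connected component of $j$. $\mathrm{QSV}_n=\{Q_\lambda:\lambda\text{ a noncrossing partition of size }n\}\subseteq S_n$, regarded as a set of points of $\mathbb{Q}^n$ by identifying $\sigma\in S_n$ with $(\sigma(1),\dots,\sigma(n))$. $\mathbf{I}(\mathrm{QSV}_n)\subseteq R_n$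 is the ideal of polynomials vanishing at all these points. *)

theory Defs
  imports Complex_Main "HOL-Library.Poly_Mapping" "HOL-Algebra.QuotRing" "HOL-Algebra.Module"
begin

section \<open>The polynomial ring in \<open>x\<^sub>1, \<dots>, x\<^sub>n\<close> over the rationals\<close>

text \<open>A monomial is its exponent vector, a polynomial a finitely supported family of coefficients.
  Multiplication on the outer \<^type>\<open>poly_mapping\<close> is convolution, so the type is the polynomial ring in
  countably many variables; \<open>R\<^sub>n\<close> is the subring of polynomials in the variables with index
  in \<open>{1..n}\<close>.\<close>

type_synonym mpoly = "(nat \<Rightarrow>\<^sub>0 nat) \<Rightarrow>\<^sub>0 rat"

definition Const :: "rat \<Rightarrow> mpoly" where
  "Const c = Poly_Mapping.single 0 c"

definition Var :: "nat \<Rightarrow> mpoly" where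
  "Var i = Poly_Mapping.single (Poly_Mapping.single i 1) 1"

definition mpoly_carrier :: "nat \<Rightarrow> mpoly set" where
  "mpoly_carrier n = {p. \<forall>m \<in> Poly_Mapping.keys p. Poly_Mapping.keys m \<subseteq> {1..n}}"

definition mpoly_ring :: "nat \<Rightarrow> mpoly ring" where
  "mpoly_ring n = \<lparr>carrier = mpoly_carrier n, mult = (*), one = 1, zero = 0, add = (+)\<rparr>"

definition mpoly_eval :: "mpoly \<Rightarrow> (nat \<Rightarrow> rat) \<Rightarrow> rat" where
  "mpoly_eval p v = (\<Sum>m \<in> Poly_Mapping.keys p.
     Poly_Mapping.lookup p m * (\<Prod>i \<in> Poly_Mapping.keys m. v i ^ Poly_Mapping.lookup m i))"

definition mpoly_scale :: "rat \<Rightarrow> mpoly \<Rightarrow> mpoly" where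
  "mpoly_scale c p = Const c * p"

lemma Const_0: "Const 0 = 0"
  by (simp add: Const_def)

lemma Const_1: "Const 1 = 1"
  by (simp add: Const_def single_one)

lemma Const_add: "Const (a + b) = Const a + Const b"
  by (simp add: Const_def single_add)

lemma Const_mult: "Const (a * b) = Const a * Const b"
  by (simp add: Const_def mult_single)

global_interpretation mpoly: vector_space mpoly_scale
  by unfold_locales (simp_all add: mpoly_scale_def Const_add Const_mult Const_1 algebra_simps)

lemma mpoly_ring_simps:
  "carrier (mpoly_ring n) = mpoly_carrier n" "mult (mpoly_ring n) = (*)" "one (mpoly_ring n) = 1"
  "zero (mpoly_ring n) = 0" "add (mpoly_ring n) = (+)"
  by (simp_all add: mpoly_ring_def)

lemma mpoly_carrier_closed:
  shows "0 \<in> mpoly_carrier n" "1 \<in> mpoly_carrier n" "Const c \<in> mpoly_carrier n"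
    and "i \<in> {1..n} \<Longrightarrow> Var i \<in> mpoly_carrier n"
    and "p \<in> mpoly_carrier n \<Longrightarrow> - p \<in> mpoly_carrier n"
    and "p \<in> mpoly_carrier n \<Longrightarrow> q \<in> mpoly_carrier n \<Longrightarrow> p + q \<in> mpoly_carrier n"
    and "p \<in> mpoly_carrier n \<Longrightarrow> q \<in> mpoly_carrier n \<Longrightarrow> p * q \<in> mpoly_carrier n"
proof -
  show "p * q \<in> mpoly_carrier n" if pq: "p \<in> mpoly_carrier n" "q \<in> mpoly_carrier n"
    unfolding mpoly_carrier_def
  proof clarify
    fix m i
    assume "m \<in> Poly_Mapping.keys (p * q)" and i: "i \<in> Poly_Mapping.keys m"
    then obtain a b where "m = a + b" "a \<in> Poly_Mapping.keys p" "b \<in> Poly_Mapping.keys q"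
      using keys_mult by blast
    with pq i Poly_Mapping.keys_add[of a b] show "i \<in> {1..n}"
      unfolding mpoly_carrier_def by blast
  qed
  show "p + q \<in> mpoly_carrier n" if "p \<in> mpoly_carrier n" "q \<in> mpoly_carrier n"
    using that Poly_Mapping.keys_add[of p q] unfolding mpoly_carrier_def by blast
  show "- p \<in> mpoly_carrier n" if "p \<in> mpoly_carrier n"
    using that by (simp add: mpoly_carrier_def keys.rep_eq)
qed (auto simp: mpoly_carrier_def Const_def Var_def)

lemma cring_mpoly_ring: "cring (mpoly_ring n)"
proof (rule cringI)
  show "abelian_group (mpoly_ring n)"
  proof (rule abelian_groupI)
    fix p assume p: "p \<in> carrier (mpoly_ring n)"
    show "\<exists>q\<in>carrier (mpoly_ring n). q \<oplus>\<^bsub>mpoly_ring n\<^esub> p = \<zero>\<^bsub>mpoly_ring n\<^esub>"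
      using p by (intro bexI[of _ "- p"]) (simp_all add: mpoly_ring_simps mpoly_carrier_closed)
  qed (simp_all add: mpoly_ring_simps mpoly_carrier_closed add_ac)
  show "comm_monoid (mpoly_ring n)"
    by (rule comm_monoidI) (simp_all add: mpoly_ring_simps mpoly_carrier_closed mult_ac)
qed (simp add: mpoly_ring_simps mpoly_carrier_closed algebra_simps)

lemma mpoly_eval_superset:
  assumes "finite M" "Poly_Mapping.keys p \<subseteq> M"
  shows "mpoly_eval p v = (\<Sum>m \<in> M.
     Poly_Mapping.lookup p m * (\<Prod>i \<in> Poly_Mapping.keys m. v i ^ Poly_Mapping.lookup m i))"
  unfolding mpoly_eval_def using assms
  by (intro sum.mono_neutral_left) (auto simp: in_keys_iff)

lemma mpoly_eval_add: "mpoly_eval (p + q) v = mpoly_eval p v + mpoly_eval q v"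
proof -
  let ?M = "Poly_Mapping.keys p \<union> Poly_Mapping.keys q"
  have fin: "finite ?M" by simp
  have sub: "Poly_Mapping.keys (p + q) \<subseteq> ?M" by (rule Poly_Mapping.keys_add)
  show ?thesis
    by (simp add: mpoly_eval_superset[OF fin sub] mpoly_eval_superset[OF fin, of p]
        mpoly_eval_superset[OF fin, of q] lookup_add algebra_simps sum.distrib)
qed

lemma monomial_eval_add:
  "(\<Prod>i \<in> Poly_Mapping.keys (a + b). (v i :: rat) ^ Poly_Mapping.lookup (a + b) i) =
   (\<Prod>i \<in> Poly_Mapping.keys a. v i ^ Poly_Mapping.lookup a i) *
   (\<Prod>i \<in> Poly_Mapping.keys b. v i ^ Poly_Mapping.lookup b i)"
proof -
  let ?M = "Poly_Mapping.keys a \<union> Poly_Mapping.keys b"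
  have *: "(\<Prod>i \<in> Poly_Mapping.keys c. v i ^ Poly_Mapping.lookup c i) =
      (\<Prod>i \<in> ?M. v i ^ Poly_Mapping.lookup c i)" if "Poly_Mapping.keys c \<subseteq> ?M" for c
    using that by (intro prod.mono_neutral_left) (auto simp: in_keys_iff)
  show ?thesis
    unfolding *[OF Poly_Mapping.keys_add] *[of a, OF Un_upper1] *[of b, OF Un_upper2]
    by (simp add: lookup_add power_add prod.distrib)
qed

lemma mpoly_eval_single:
  "mpoly_eval (Poly_Mapping.single m c) v = c * (\<Prod>i \<in> Poly_Mapping.keys m. v i ^ Poly_Mapping.lookup m i)"
  by (simp add: mpoly_eval_def)

lemma mpoly_induct:
  fixes p :: mpoly
  assumes "P 0" and "\<And>m c. P (Poly_Mapping.single m c)" and "\<And>p q. P p \<Longrightarrow> P q \<Longrightarrow> P (p + q)"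
  shows "P p"
proof (induction p rule: update_induct)
  case const
  show ?case by (rule assms(1))
next
  case (update f a b)
  have "Poly_Mapping.update a b f = f + Poly_Mapping.single a b"
    using update.hyps
    by (intro poly_mapping_eqI) (auto simp: lookup_update lookup_add lookup_single in_keys_iff when_def)
  then show ?case using assms(2,3) update.IH by simp
qed

lemma mpoly_eval_mult: "mpoly_eval (p * q) v = mpoly_eval p v * mpoly_eval q v"
proof -
  have zero: "mpoly_eval 0 v = 0" by (simp add: mpoly_eval_def)
  have single: "mpoly_eval (Poly_Mapping.single m c * q) v =
      mpoly_eval (Poly_Mapping.single m c) v * mpoly_eval q v" for m c
    by (induction q rule: mpoly_induct)
      (simp_all add: zero mult_single mpoly_eval_single monomial_eval_add mpoly_eval_add
        distrib_left)
  show ?thesis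
    by (induction p rule: mpoly_induct)
      (simp_all add: zero single mpoly_eval_add distrib_right)
qed


section \<open>Quasisymmetric polynomials\<close>

definition composition :: "nat list \<Rightarrow> bool" where
  "composition \<alpha> \<longleftrightarrow> (\<forall>a \<in> set \<alpha>. 0 < a)"

text \<open>The lists \<open>js\<close> are the index sequences \<open>1 \<le> i\<^sub>1 < \<dots> < i\<^sub>k \<le> n\<close>.\<close>

definition monomial_qsym :: "nat \<Rightarrow> nat list \<Rightarrow> mpoly" where
  "monomial_qsym n \<alpha> =
     (\<Sum>js \<in> {js. length js = length \<alpha> \<and> sorted_wrt (<) js \<and> set js \<subseteq> {1..n}}.
        \<Prod>t<length \<alpha>. Var (js ! t) ^ (\<alpha> ! t))"

definition qsym_plus :: "nat \<Rightarrow> mpoly set" where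
  "qsym_plus n =
     mpoly.span {monomial_qsym n \<alpha> | \<alpha>. composition \<alpha> \<and> \<alpha> \<noteq> [] \<and> length \<alpha> \<le> n}"

definition qsym_ideal :: "nat \<Rightarrow> mpoly set" where
  "qsym_ideal n = Idl\<^bsub>mpoly_ring n\<^esub> (qsym_plus n)"

lemma monomial_qsym_carrier: "monomial_qsym n \<alpha> \<in> mpoly_carrier n"
proof -
  have pow: "p ^ k \<in> mpoly_carrier n" if "p \<in> mpoly_carrier n" for p k
    by (induction k) (simp_all add: mpoly_carrier_closed that)
  have prod: "prod f B \<in> mpoly_carrier n" if "\<And>x. x \<in> B \<Longrightarrow> f x \<in> mpoly_carrier n"
    for f :: "nat \<Rightarrow> mpoly" and B
    using that by (induction B rule: infinite_finite_induct) (simp_all add: mpoly_carrier_closed)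
  have sum: "sum f B \<in> mpoly_carrier n" if "\<And>x. x \<in> B \<Longrightarrow> f x \<in> mpoly_carrier n"
    for f :: "nat list \<Rightarrow> mpoly" and B
    using that by (induction B rule: infinite_finite_induct) (simp_all add: mpoly_carrier_closed)
  show ?thesis
    unfolding monomial_qsym_def
  proof (intro sum prod pow mpoly_carrier_closed(4))
    fix js t
    assume "js \<in> {js. length js = length \<alpha> \<and> sorted_wrt (<) js \<and> set js \<subseteq> {1..n}}"
      and "t \<in> {..<length \<alpha>}"
    then show "js ! t \<in> {1..n}" using subsetD[OF _ nth_mem, of js "{1..n}" t] by simp
  qed
qed

lemma qsym_plus_carrier: "qsym_plus n \<subseteq> mpoly_carrier n"
  unfolding qsym_plus_def
  by (rule mpoly.span_minimal)
    (auto simp: monomial_qsym_carrier mpoly.subspace_def mpoly_carrier_closed mpoly_scale_def)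

lemma ideal_qsym_ideal: "ideal (qsym_ideal n) (mpoly_ring n)"
  unfolding qsym_ideal_def
  by (rule ring.genideal_ideal)
    (simp_all add: cring.axioms cring_mpoly_ring mpoly_ring_simps qsym_plus_carrier)


section \<open>Noncrossing partitions and the quasisymmetric variety\<close>

definition noncrossing_partition :: "nat \<Rightarrow> (nat \<times> nat) set \<Rightarrow> bool" where
  "noncrossing_partition n A \<longleftrightarrow>
     (\<forall>(i, j) \<in> A. 1 \<le> i \<and> i < j \<and> j \<le> n) \<and>
     \<not> (\<exists>i j k l. (i, k) \<in> A \<and> (j, l) \<in> A \<and> (i, k) \<noteq> (j, l) \<and> i \<le> j \<and> j < k \<and> k \<le> l)"

definition arc_component :: "nat \<Rightarrow> (nat \<times> nat) set \<Rightarrow> nat \<Rightarrow> nat set" where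
  "arc_component n A j = {k \<in> {1..n}. (j, k) \<in> (A \<union> A\<inverse>)\<^sup>*}"

text \<open>In a noncrossing partition at most one arc has right endpoint \<open>j\<close> (two such arcs would violate
  the defining condition with \<open>k = l\<close>), so the description below is unique.
  Outside \<open>{1..n}\<close> the permutation is the identity.\<close>

definition Q_perm :: "nat \<Rightarrow> (nat \<times> nat) set \<Rightarrow> nat \<Rightarrow> nat" where
  "Q_perm n A j =
     (if j \<notin> {1..n} then j
      else if \<exists>i. (i, j) \<in> A then THE i. (i, j) \<in> A
      else Max (arc_component n A j))"

definition QSV :: "nat \<Rightarrow> (nat \<Rightarrow> nat) set" where
  "QSV n = {Q_perm n A | A. noncrossing_partition n A}"

text \<open>\<open>\<sigma>\<close> is the point \<open>(\<sigma>(1), \<dots>, \<sigma>(n))\<close>; polynomials in \<open>R\<^sub>n\<close> do not see the remaining coordinates.\<close>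

definition vanishing_ideal :: "nat \<Rightarrow> (nat \<Rightarrow> nat) set \<Rightarrow> mpoly set" where
  "vanishing_ideal n S =
     {p \<in> carrier (mpoly_ring n). \<forall>\<sigma> \<in> S. mpoly_eval p (\<lambda>i. of_nat (\<sigma> i)) = 0}"

lemma ideal_vanishing_ideal: "ideal (vanishing_ideal n S) (mpoly_ring n)"
proof -
  interpret cring "mpoly_ring n" by (rule cring_mpoly_ring)
  have uminus: "\<ominus>\<^bsub>mpoly_ring n\<^esub> p = - p" if "p \<in> carrier (mpoly_ring n)" for p
    using that by (intro minus_equality) (simp_all add: mpoly_ring_simps mpoly_carrier_closed)
  have eval_uminus: "mpoly_eval (- p) v = - mpoly_eval p v" for p v
    using mpoly_eval_add[of p "- p" v] by (simp add: mpoly_eval_def)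
  show ?thesis
  proof (rule idealI)
    show "ring (mpoly_ring n)" by unfold_locales
    show "subgroup (vanishing_ideal n S) (add_monoid (mpoly_ring n))"
    proof (rule add.subgroupI)
      have "0 \<in> vanishing_ideal n S"
        by (simp add: vanishing_ideal_def mpoly_ring_simps mpoly_carrier_closed mpoly_eval_def)
      then show "vanishing_ideal n S \<noteq> {}" by blast
      fix p assume "p \<in> vanishing_ideal n S"
      then show "\<ominus>\<^bsub>mpoly_ring n\<^esub> p \<in> vanishing_ideal n S"
        by (auto simp: vanishing_ideal_def uminus eval_uminus)
           (simp add: mpoly_ring_simps mpoly_carrier_closed)
    qed (auto simp: vanishing_ideal_def mpoly_ring_simps mpoly_carrier_closed mpoly_eval_add)
  qed (auto simp: vanishing_ideal_def mpoly_ring_simps mpoly_carrier_closed mpoly_eval_mult)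
qed


section \<open>Quotients as rational vector spaces\<close>

definition rat_ring :: "rat ring" where
  "rat_ring = \<lparr>carrier = UNIV, mult = (*), one = 1, zero = 0, add = (+)\<rparr>"

lemma cring_rat_ring: "cring rat_ring"
proof (rule cringI)
  show "abelian_group rat_ring"
  proof (rule abelian_groupI)
    fix x assume "x \<in> carrier rat_ring"
    show "\<exists>y\<in>carrier rat_ring. y \<oplus>\<^bsub>rat_ring\<^esub> x = \<zero>\<^bsub>rat_ring\<^esub>"
      by (intro bexI[of _ "- x"]) (simp_all add: rat_ring_def)
  qed (simp_all add: rat_ring_def)
  show "comm_monoid rat_ring"
    by (rule comm_monoidI) (simp_all add: rat_ring_def)
qed (simp add: rat_ring_def algebra_simps)

text \<open>The quotient ring \<open>R\<^sub>n/I\<close> with the scalar action \<open>c \<cdot> (p + I) = (c + I) (p + I) = c p + I\<close>.\<close>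

definition quotient_space :: "nat \<Rightarrow> mpoly set \<Rightarrow> (rat, mpoly set) module" where
  "quotient_space n I = ring.extend (mpoly_ring n Quot I)
     \<lparr>smult = (\<lambda>c C. (I +>\<^bsub>mpoly_ring n\<^esub> Const c) \<otimes>\<^bsub>mpoly_ring n Quot I\<^esub> C)\<rparr>"

lemma quotient_space_simps:
  "carrier (quotient_space n I) = a_rcosets\<^bsub>mpoly_ring n\<^esub> I"
  "add (quotient_space n I) = add (mpoly_ring n Quot I)"
  "zero (quotient_space n I) = zero (mpoly_ring n Quot I)"
  "smult (quotient_space n I) c C = (I +>\<^bsub>mpoly_ring n\<^esub> Const c) \<otimes>\<^bsub>mpoly_ring n Quot I\<^esub> C"
  by (simp_all add: quotient_space_def ring.defs FactRing_def)

lemma quotient_space_smult: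
  assumes "ideal I (mpoly_ring n)" "p \<in> carrier (mpoly_ring n)"
  shows "c \<odot>\<^bsub>quotient_space n I\<^esub> (I +>\<^bsub>mpoly_ring n\<^esub> p) = I +>\<^bsub>mpoly_ring n\<^esub> (mpoly_scale c p)"
  using ideal.rcoset_mult_add[OF assms(1), of "Const c" p] assms(2)
  by (simp add: quotient_space_simps FactRing_def mpoly_scale_def mpoly_ring_simps mpoly_carrier_closed)

lemma module_quotient_space:
  assumes "ideal I (mpoly_ring n)"
  shows "Module.module rat_ring (quotient_space n I)"
proof -
  let ?Q = "mpoly_ring n Quot I"
  interpret I: ideal I "mpoly_ring n" by (rule assms)
  interpret Q: ring ?Q by (rule I.quotient_is_ring)
  let ?h = "\<lambda>c. I +>\<^bsub>mpoly_ring n\<^esub> Const c"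
  have C: "Const c \<in> carrier (mpoly_ring n)" for c
    by (simp add: mpoly_ring_simps mpoly_carrier_closed)
  have car: "carrier ?Q = a_rcosets\<^bsub>mpoly_ring n\<^esub> I" by (simp add: FactRing_def)
  have h: "?h c \<in> carrier ?Q" for c
    using C by (simp add: car I.a_rcosetsI I.a_subset)
  have h_add: "?h (a + b) = ?h a \<oplus>\<^bsub>?Q\<^esub> ?h b" for a b
    using I.a_rcos_sum[OF C C, of a b] by (simp add: FactRing_def Const_add mpoly_ring_simps)
  have h_mult: "?h (a * b) = ?h a \<otimes>\<^bsub>?Q\<^esub> ?h b" for a b
    using I.rcoset_mult_add[OF C C, of a b] by (simp add: FactRing_def Const_mult mpoly_ring_simps)
  have h_one: "?h 1 = \<one>\<^bsub>?Q\<^esub>"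
    by (simp add: FactRing_def Const_1 mpoly_ring_simps)
  show ?thesis
  proof (rule moduleI[OF cring_rat_ring])
    show "abelian_group (quotient_space n I)"
    proof (rule abelian_groupI)
      fix x assume "x \<in> carrier (quotient_space n I)"
      then show "\<exists>y\<in>carrier (quotient_space n I). y \<oplus>\<^bsub>quotient_space n I\<^esub> x = \<zero>\<^bsub>quotient_space n I\<^esub>"
        by (intro bexI[of _ "\<ominus>\<^bsub>?Q\<^esub> x"])
           (simp_all add: quotient_space_simps flip: car, simp add: Q.l_neg)
    qed (simp_all add: quotient_space_simps Q.a_ac flip: car)
  qed (simp_all add: quotient_space_simps rat_ring_def h h_add h_mult h_one
         Q.l_distr Q.r_distr Q.m_assoc flip: car)
qed

definition module_iso :: "('k, 'r) ring_scheme \<Rightarrow> ('k, 'a, 'c) module_scheme \<Rightarrow>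
    ('k, 'b, 'd) module_scheme \<Rightarrow> ('a \<Rightarrow> 'b) set" where
  "module_iso K V W = {f. bij_betw f (carrier V) (carrier W) \<and>
     (\<forall>x \<in> carrier V. \<forall>y \<in> carrier V. f (x \<oplus>\<^bsub>V\<^esub> y) = f x \<oplus>\<^bsub>W\<^esub> f y) \<and>
     (\<forall>c \<in> carrier K. \<forall>x \<in> carrier V. f (c \<odot>\<^bsub>V\<^esub> x) = c \<odot>\<^bsub>W\<^esub> f x)}"

end

theory Submission
  imports Defs
begin

text \<open>The monomials \<open>x\<^sup>\<nu>\<close> with \<open>\<nu>\<^sub>1 + \<dots> + \<nu>\<^sub>i < i\<close> for all \<open>i\<close> (the ballot monomials) span a common
  complement of both ideals. They span modulo \<open>\<langle>QSym\<^sub>n\<^sup>+\<rangle>\<close> by a straightening argument with fundamental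
  quasisymmetric polynomials.

  The two ideals are linked as follows. Put \<open>A(t) = 1 + \<Sum>\<^sub>m t\<^sup>m z\<^sub>m\<close> with noncommuting \<open>z\<^sub>m\<close>. The coefficient
  of \<open>z\<^sub>\<alpha>\<close> in \<open>A(x\<^sub>1) A(1)\<^sup>-\<^sup>1 A(x\<^sub>2) A(2)\<^sup>-\<^sup>1 \<dots> A(x\<^sub>n) A(n)\<^sup>-\<^sup>1\<close> has leading form \<open>M\<^sub>\<alpha>\<close>, and it vanishes on
  \<open>QSV\<^sub>n\<close> because the product telescopes to \<open>1\<close> at every \<open>Q\<^sub>\<lambda>\<close>. So all homogeneous elements of
  \<open>\<langle>QSym\<^sub>n\<^sup>+\<rangle>\<close> are leading forms of polynomials vanishing on \<open>QSV\<^sub>n\<close>, and the ballot monomials span modulo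
  the vanishing ideal too. There are at most \<open>|QSV\<^sub>n|\<close> of them, hence they are independent modulo the
  vanishing ideal, and passing to leading forms also modulo \<open>\<langle>QSym\<^sub>n\<^sup>+\<rangle>\<close>.\<close>

section \<open>Straightening modulo quasisymmetric polynomials\<close>

abbreviation mon :: "(nat \<Rightarrow>\<^sub>0 nat) \<Rightarrow> mpoly" where
  "mon m \<equiv> Poly_Mapping.single m 1"

text \<open>Summing over the fixed range \<open>{1..n}\<close> instead of the keys makes the degree
  visibly additive; on R_n it is the total degree.\<close>

definition mdeg :: "nat \<Rightarrow> (nat \<Rightarrow>\<^sub>0 nat) \<Rightarrow> nat" where
  "mdeg n m = (\<Sum>i=1..n. Poly_Mapping.lookup m i)"

lemma mdeg_0 [simp]: "mdeg n 0 = 0"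
  by (simp add: mdeg_def)

lemma mdeg_add: "mdeg n (a + b) = mdeg n a + mdeg n b"
  by (simp add: mdeg_def lookup_add sum.distrib)

lemma mdeg_single: "i \<in> {1..n} \<Longrightarrow> mdeg n (Poly_Mapping.single i k) = k"
  by (simp add: mdeg_def lookup_single when_def sum.delta')

lemma keys_add_nat: "Poly_Mapping.keys (a + b) = Poly_Mapping.keys a \<union> Poly_Mapping.keys (b :: nat \<Rightarrow>\<^sub>0 nat)"
  by (auto simp: in_keys_iff lookup_add)

lemma mon_mult: "mon a * mon b = mon (a + b)"
  by (simp add: mult_single)

lemma Var_power: "Var i ^ k = mon (Poly_Mapping.single i k)"
proof (induction k)
  case (Suc k)
  then show ?case by (simp add: Var_def mult_single flip: single_add)
qed simp

lemma single_eq_scale: "Poly_Mapping.single m c = mpoly_scale c (mon m)"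
  by (simp add: mpoly_scale_def Const_def mult_single)

lemma mpoly_scale_mult: "mpoly_scale c (p * q) = p * mpoly_scale c q"
  by (simp add: mpoly_scale_def mult.left_commute)

lemma mult_in_subspace:
  assumes "q \<in> mpoly.span S" "mpoly.subspace V" "\<And>s. s \<in> S \<Longrightarrow> p * s \<in> V"
  shows "p * q \<in> V"
  using assms(1)
proof (induction q rule: mpoly.span_induct_alt)
  case base
  then show ?case using assms(2) by (simp add: mpoly.subspace_0)
next
  case (step c x y)
  then show ?case using assms(2,3)
    by (simp add: distrib_left mpoly.subspace_add mpoly.subspace_scale flip: mpoly_scale_mult)
qed

lemma in_span_mon_keys: "p \<in> mpoly.span (mon ` Poly_Mapping.keys p)"
proof -
  have "p = (\<Sum>m\<in>Poly_Mapping.keys p. mpoly_scale (Poly_Mapping.lookup p m) (mon m))"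
    by (rule poly_mapping_eqI)
      (auto simp: lookup_sum lookup_single when_def in_keys_iff simp flip: single_eq_scale)
  also have "\<dots> \<in> mpoly.span (mon ` Poly_Mapping.keys p)"
    by (intro mpoly.span_sum mpoly.span_scale mpoly.span_base) auto
  finally show ?thesis .
qed

definition hom_polys :: "nat \<Rightarrow> nat \<Rightarrow> nat \<Rightarrow> mpoly set" where
  "hom_polys n s d = mpoly.span (mon ` {m. Poly_Mapping.keys m \<subseteq> {s..n} \<and> mdeg n m = d})"

lemma hom_polys_Var:
  assumes "p \<in> hom_polys n s d" "x \<in> {s..n}" "1 \<le> s"
  shows "Var x * p \<in> hom_polys n s (Suc d)"
proof -
  have *: "Var x * mon m \<in> hom_polys n s (Suc d)" if "Poly_Mapping.keys m \<subseteq> {s..n}" "mdeg n m = d" for m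
    unfolding hom_polys_def Var_def mon_mult
    using that assms(2,3)
    by (intro mpoly.span_base imageI) (auto simp: keys_add_nat mdeg_add mdeg_single)
  show ?thesis
    using assms(1) unfolding hom_polys_def
    by (rule mult_in_subspace) (use * in \<open>auto simp: hom_polys_def\<close>)
qed

text \<open>The fundamental quasisymmetric polynomial in the listed variables. The composition is encoded
  by its parts minus one, so that \<open>length w + sum_list w\<close> is the degree.\<close>

function fundamental :: "nat list \<Rightarrow> nat list \<Rightarrow> mpoly" where
  "fundamental xs [] = 1"
| "fundamental [] (k # w) = 0"
| "fundamental (x # xs) (0 # w) = fundamental xs (0 # w) + Var x * fundamental xs w"
| "fundamental (x # xs) (Suc k # w) = fundamental xs (Suc k # w) + Var x * fundamental (x # xs) (k # w)"
  by pat_completeness auto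
termination by (relation "measure (\<lambda>(xs, w). length xs + sum_list w)") auto

text \<open>Iterating the recursion sorts the monomials by their exponent of the first variable:
  either \<open>x\<close> fills the whole first part, or it supplies only \<open>j\<close> of the
  \<open>Suc k\<close> units and later variables complete the part.\<close>

lemma fundamental_Cons:
  "fundamental (x # xs) (k # w) =
     Var x ^ Suc k * fundamental xs w + (\<Sum>j\<le>k. Var x ^ j * fundamental xs ((k - j) # w))"
proof (induction k)
  case (Suc k)
  have "(\<Sum>j\<le>Suc k. Var x ^ j * fundamental xs ((Suc k - j) # w)) =
      fundamental xs (Suc k # w) + Var x * (\<Sum>j\<le>k. Var x ^ j * fundamental xs ((k - j) # w))"
    by (simp only: sum.atMost_Suc_shift) (simp add: sum_distrib_left mult.assoc)
  then show ?case using Suc by (simp add: algebra_simps)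
qed simp

lemma fundamental_hom:
  assumes "set xs \<subseteq> {s..n}" "1 \<le> s"
  shows "fundamental xs w \<in> hom_polys n s (length w + sum_list w)"
  using assms
proof (induction xs w rule: fundamental.induct)
  case (1 xs)
  then show ?case
    unfolding hom_polys_def
    by (intro mpoly.span_base image_eqI[where x = 0]) auto
next
  case (2 k w)
  then show ?case by (simp add: hom_polys_def mpoly.span_zero)
next
  case (3 x xs w)
  then have "Var x * fundamental xs w \<in> hom_polys n s (Suc (length w + sum_list w))"
    by (intro hom_polys_Var) auto
  with 3 show ?case by (simp add: hom_polys_def mpoly.span_add)
next
  case (4 x xs k w)
  then have "Var x * fundamental (x # xs) (k # w) \<in> hom_polys n s (Suc (length (k # w) + sum_list (k # w)))"
    by (intro hom_polys_Var) auto
  with 4 show ?case by (simp add: hom_polys_def mpoly.span_add)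
qed

text \<open>The ballot condition still to be met by x_s, ..., x_n once the earlier exponents are
  fixed; \<open>r\<close> is the slack they left. An exponent \<open>a\<close> of x_s turns slack
  \<open>r\<close> into \<open>Suc r - a\<close>; the original condition is \<open>s = 1\<close>,
  \<open>r = 0\<close>.\<close>

definition ballot :: "nat \<Rightarrow> nat \<Rightarrow> nat \<Rightarrow> (nat \<Rightarrow>\<^sub>0 nat) set" where
  "ballot n s r = {\<nu>. Poly_Mapping.keys \<nu> \<subseteq> {s..n} \<and>
     (\<forall>i \<in> {s..n}. (\<Sum>j=s..i. Poly_Mapping.lookup \<nu> j) < i + 1 - s + r)}"

text \<open>\<open>sum_list w\<close> is the excess of the composition: degree minus number of
  parts. Its threshold follows the slack of \<open>ballot\<close>; at \<open>r = 0\<close> every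
  non-empty composition qualifies.\<close>

definition excess_products :: "nat \<Rightarrow> nat \<Rightarrow> nat \<Rightarrow> nat \<Rightarrow> mpoly set" where
  "excess_products n s r d = {mon \<mu> * fundamental [s..<Suc n] w | \<mu> w.
     Poly_Mapping.keys \<mu> \<subseteq> {s..n} \<and> w \<noteq> [] \<and> r \<le> sum_list w \<and>
     mdeg n \<mu> + (length w + sum_list w) = d}"

text \<open>Solve the recursion of \<open>fundamental\<close> for the polynomial without x_s. The
  correction is x_s times a polynomial that has either one unit of excess less, hence the hypothesis
  \<open>Suc r\<close>, or one part fewer and the same excess, which the induction covers.\<close>

lemma shifted_fundamental_in_span:
  assumes "1 \<le> s" "s \<le> n" "w \<noteq> []" "Suc r \<le> sum_list w"
    "Poly_Mapping.keys \<mu> \<subseteq> {s..n}" "mdeg n \<mu> + (length w + sum_list w) = d"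
  shows "mon \<mu> * fundamental [Suc s..<Suc n] w \<in> mpoly.span (excess_products n s r d)"
  using assms(3-6)
proof (induction w arbitrary: \<mu>)
  case (Cons k w)
  let ?xs = "[Suc s..<Suc n]" and ?e = "Poly_Mapping.single s (Suc 0)"
  have xs: "[s..<Suc n] = s # ?xs" using assms(2) by (simp add: upt_rec)
  have e: "Poly_Mapping.keys (\<mu> + ?e) \<subseteq> {s..n}" "mdeg n (\<mu> + ?e) = Suc (mdeg n \<mu>)"
    using Cons.prems(3) assms(1,2) by (auto simp: keys_add_nat mdeg_add mdeg_single)
  have eV: "mon (\<mu> + ?e) = mon \<mu> * Var s" by (simp add: Var_def mon_mult)
  have 1: "mon \<mu> * fundamental (s # ?xs) (k # w) \<in> mpoly.span (excess_products n s r d)"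
    using Cons.prems unfolding excess_products_def xs
    by (intro mpoly.span_base) (auto intro!: exI[of _ \<mu>] exI[of _ "k # w"])
  show ?case
  proof (cases k)
    case 0
    \<comment> \<open>The first part contributes no excess here, so the positive excess sits in
      \<open>w\<close>.\<close>
    have "w \<noteq> []" using Cons.prems(2) 0 by auto
    then have "mon (\<mu> + ?e) * fundamental ?xs w \<in> mpoly.span (excess_products n s r d)"
      using Cons.prems e 0 by (intro Cons.IH) auto
    moreover have "mon \<mu> * fundamental ?xs (k # w) =
        mon \<mu> * fundamental (s # ?xs) (k # w) - mon (\<mu> + ?e) * fundamental ?xs w"
      unfolding 0 fundamental.simps eV by (simp add: algebra_simps del: upt_Suc)
    ultimately show ?thesis using 1 by (simp add: mpoly.span_diff del: upt_Suc)
  next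
    case (Suc k')
    have "mon (\<mu> + ?e) * fundamental (s # ?xs) (k' # w) \<in> mpoly.span (excess_products n s r d)"
      using Cons.prems e Suc unfolding excess_products_def xs
      by (intro mpoly.span_base) (auto intro!: exI[of _ "\<mu> + ?e"] exI[of _ "k' # w"])
    moreover have "mon \<mu> * fundamental ?xs (k # w) =
        mon \<mu> * fundamental (s # ?xs) (k # w) - mon (\<mu> + ?e) * fundamental (s # ?xs) (k' # w)"
      unfolding Suc fundamental.simps eV by (simp add: algebra_simps del: upt_Suc)
    ultimately show ?thesis using 1 by (simp add: mpoly.span_diff del: upt_Suc)
  qed
qed simp

lemma ballot_Cons:
  assumes \<nu>: "\<nu> \<in> ballot n (Suc s) (Suc r - a)" and "a \<le> r" "s \<le> n"
  shows "Poly_Mapping.single s a + \<nu> \<in> ballot n s r"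
proof -
  have keys: "Poly_Mapping.keys \<nu> \<subseteq> {Suc s..n}" using \<nu> by (simp add: ballot_def)
  then have "s \<notin> Poly_Mapping.keys \<nu>" by auto
  then have s: "Poly_Mapping.lookup \<nu> s = 0" by (simp add: in_keys_iff)
  have "(\<Sum>j=s..i. Poly_Mapping.lookup (Poly_Mapping.single s a + \<nu>) j) < i + 1 - s + r"
    if i: "i \<in> {s..n}" for i
  proof -
    have "(\<Sum>j=s..i. Poly_Mapping.lookup (Poly_Mapping.single s a + \<nu>) j)
        = a + (\<Sum>j=Suc s..i. Poly_Mapping.lookup (Poly_Mapping.single s a + \<nu>) j)"
      using i s by (simp add: sum.atLeast_Suc_atMost lookup_add)
    also have "(\<Sum>j=Suc s..i. Poly_Mapping.lookup (Poly_Mapping.single s a + \<nu>) j)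
        = (\<Sum>j=Suc s..i. Poly_Mapping.lookup \<nu> j)"
      by (intro sum.cong) (auto simp: lookup_add lookup_single)
    finally have eq: "(\<Sum>j=s..i. Poly_Mapping.lookup (Poly_Mapping.single s a + \<nu>) j)
        = a + (\<Sum>j=Suc s..i. Poly_Mapping.lookup \<nu> j)" .
    show ?thesis
    proof (cases "i = s")
      case False
      then have "(\<Sum>j=Suc s..i. Poly_Mapping.lookup \<nu> j) < i + 1 - Suc s + (Suc r - a)"
        using \<nu> i unfolding ballot_def by simp
      then show ?thesis unfolding eq using i assms(2) False by simp
    qed (use eq assms(2) in simp)
  qed
  then show ?thesis using keys assms(3) by (auto simp: ballot_def keys_add_nat split: if_splits)
qed

text \<open>Induction on the number of variables, then on the power \<open>a\<close> of the first one: modulo lower powers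
  of \<open>x\<^sub>s\<close>, the product of \<open>x\<^sub>s\<^sup>a\<close> and a fundamental polynomial in the later variables is the
  fundamental polynomial with the additional first part \<open>a\<close>.\<close>

lemma mon_in_span_ballot:
  assumes "s \<le> Suc n" "1 \<le> s" "Poly_Mapping.keys m \<subseteq> {s..n}" "mdeg n m = d"
  shows "mon m \<in> mpoly.span (mon ` {\<nu> \<in> ballot n s r. mdeg n \<nu> = d} \<union> excess_products n s r d)"
  using assms
proof (induction s arbitrary: m d r rule: inc_induct)
  case base
  then have "m = 0" by (auto simp flip: keys_eq_empty)
  then show ?case using base by (intro mpoly.span_base) (auto simp: ballot_def)
next
  case (step s)
  let ?xs = "[Suc s..<Suc n]"
  define V where "V = mpoly.span (mon ` {\<nu> \<in> ballot n s r. mdeg n \<nu> = d} \<union> excess_products n s r d)"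
  have V: "mpoly.subspace V" by (simp add: V_def)
  have s: "1 \<le> s" "s \<le> n" "s \<in> {1..n}" using step.hyps step.prems by auto
  have xs: "[s..<Suc n] = s # ?xs" using s by (simp add: upt_rec)
  have xs_set: "set ?xs \<subseteq> {Suc s..n}" by auto
  have main: "mon (Poly_Mapping.single s a + m') \<in> V"
    if "Poly_Mapping.keys m' \<subseteq> {Suc s..n}" "a + mdeg n m' = d" for a m'
    using that
  proof (induction a arbitrary: m' rule: less_induct)
    case (less a)
    have lower: "Var s ^ j * q \<in> V" if "j < a" "q \<in> hom_polys n (Suc s) e" "j + e = d" for j q e
      using that less.IH[of j] unfolding hom_polys_def
      by (elim mult_in_subspace[OF _ V]) (auto simp: Var_power mon_mult)
    have mon_hom: "mon \<mu> * q \<in> hom_polys n (Suc s) (mdeg n \<mu> + e)"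
      if "Poly_Mapping.keys \<mu> \<subseteq> {Suc s..n}" "q \<in> hom_polys n (Suc s) e" for \<mu> q e
      using that(2) unfolding hom_polys_def
      by (elim mult_in_subspace)
        (use that(1) in \<open>auto simp: mon_mult keys_add_nat mdeg_add intro!: mpoly.span_base imageI\<close>)
    \<comment> \<open>The new first part \<open>a\<close> adds \<open>a - 1\<close> to the excess of
      \<open>w\<close>; the condition says that the extended composition reaches
      \<open>r\<close>.\<close>
    have lead: "Var s ^ a * (mon \<mu> * fundamental ?xs w) \<in> V"
      if a: "0 < a" "r \<le> a - 1 + sum_list w" and \<mu>: "Poly_Mapping.keys \<mu> \<subseteq> {Suc s..n}"
        and d: "a + (mdeg n \<mu> + (length w + sum_list w)) = d" for \<mu> w
    proof -
      obtain k where k: "a = Suc k" using a by (cases a) auto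
      have "mon \<mu> * fundamental (s # ?xs) (k # w) \<in> excess_products n s r d"
        using a \<mu> d k unfolding excess_products_def xs
        by (intro CollectI exI[of _ \<mu>] exI[of _ "k # w"]) force
      then have 1: "mon \<mu> * fundamental (s # ?xs) (k # w) \<in> V"
        by (auto simp: V_def intro: mpoly.span_base)
      have 2: "Var s ^ j * (mon \<mu> * fundamental ?xs ((k - j) # w)) \<in> V" if "j \<le> k" for j
        using that k d
        by (intro lower[OF _ mon_hom[OF \<mu> fundamental_hom[OF xs_set]]]) auto
      have "Var s ^ a * (mon \<mu> * fundamental ?xs w) = mon \<mu> * fundamental (s # ?xs) (k # w)
          - (\<Sum>j\<le>k. Var s ^ j * (mon \<mu> * fundamental ?xs ((k - j) # w)))"
        unfolding k fundamental_Cons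
        by (simp add: distrib_left sum_distrib_left mult.left_commute del: upt_Suc power_Suc)
      also have "\<dots> \<in> V"
        using V 1 2 by (intro mpoly.subspace_diff mpoly.subspace_sum) auto
      finally show ?thesis .
    qed
    have split: "mon (Poly_Mapping.single s a + m') = Var s ^ a * mon m'"
      by (simp add: Var_power mon_mult)
    show ?case
    proof (cases "a \<le> r")
      case False
      \<comment> \<open>For \<open>a > r\<close> the single part \<open>a\<close> already has excess
        \<open>a - 1\<close>, at least \<open>r\<close>.\<close>
      then show ?thesis using lead[where \<mu> = m' and w = "[]"] less.prems split by simp
    next
      case True
      \<comment> \<open>The slack after x_s^a is \<open>Suc r - a\<close>. Ballot monomials prolong
        by \<open>ballot_Cons\<close>; for \<open>a > 0\<close> the excess products gain the part
        \<open>a\<close>, and a - 1 + (Suc r - a) = r.\<close>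
      have "mon m' \<in> mpoly.span (mon ` {\<nu> \<in> ballot n (Suc s) (Suc r - a). mdeg n \<nu> = mdeg n m'}
          \<union> excess_products n (Suc s) (Suc r - a) (mdeg n m'))"
        using less.prems by (intro step.IH) auto
      then show ?thesis
        unfolding split
      proof (rule mult_in_subspace[OF _ V])
        fix t assume "t \<in> mon ` {\<nu> \<in> ballot n (Suc s) (Suc r - a). mdeg n \<nu> = mdeg n m'}
          \<union> excess_products n (Suc s) (Suc r - a) (mdeg n m')"
        then show "Var s ^ a * t \<in> V"
        proof
          assume "t \<in> mon ` {\<nu> \<in> ballot n (Suc s) (Suc r - a). mdeg n \<nu> = mdeg n m'}"
          then obtain \<nu> where \<nu>: "t = mon \<nu>" "\<nu> \<in> ballot n (Suc s) (Suc r - a)" "mdeg n \<nu> = mdeg n m'"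
            by auto
          then have "Poly_Mapping.single s a + \<nu> \<in> ballot n s r"
            using True s by (intro ballot_Cons) auto
          then show ?thesis
            using \<nu> less.prems s
            by (auto simp: V_def Var_power mon_mult mdeg_add mdeg_single
                intro!: mpoly.span_base)
        next
          assume "t \<in> excess_products n (Suc s) (Suc r - a) (mdeg n m')"
          then obtain \<mu> w where t: "t = mon \<mu> * fundamental ?xs w"
            "Poly_Mapping.keys \<mu> \<subseteq> {Suc s..n}" "w \<noteq> []" "Suc r - a \<le> sum_list w"
            "mdeg n \<mu> + (length w + sum_list w) = mdeg n m'"
            unfolding excess_products_def by blast
          show ?thesis
          proof (cases "a = 0")
            case False
            then show ?thesis unfolding t(1) using t less.prems by (intro lead) auto
          next
            case True
            \<comment> \<open>For \<open>a = 0\<close> no part is gained, but the excess is at least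
              \<open>Suc r\<close>, which pays for putting x_s back among the variables.\<close>
            have "Poly_Mapping.keys \<mu> \<subseteq> {s..n}" using t(2) by force
            then have "t \<in> mpoly.span (excess_products n s r d)"
              unfolding t(1) using t less.prems True s
              by (intro shifted_fundamental_in_span) auto
            then show ?thesis
              using True mpoly.span_mono[of "excess_products n s r d"] by (auto simp: V_def)
          qed
        qed
      qed
    qed
  qed
  define m' where "m' = Poly_Mapping.update s 0 m"
  have m: "m = Poly_Mapping.single s (Poly_Mapping.lookup m s) + m'"
    by (rule poly_mapping_eqI) (auto simp: m'_def lookup_add lookup_single lookup_update when_def)
  have km: "Poly_Mapping.keys m' \<subseteq> {Suc s..n}"
  proof
    fix i assume "i \<in> Poly_Mapping.keys m'"
    then have "i \<noteq> s" "i \<in> Poly_Mapping.keys m"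
      by (auto simp: m'_def in_keys_iff lookup_update split: if_splits)
    then show "i \<in> {Suc s..n}" using step.prems by force
  qed
  have "Poly_Mapping.lookup m s + mdeg n m' = d"
    using arg_cong[OF m, of "mdeg n"] step.prems s by (simp add: mdeg_add mdeg_single)
  from main[OF km this] show ?case using m by (simp add: V_def)
qed


section \<open>Noncrossing partitions\<close>

lemma noncrossing_bounds:
  assumes "noncrossing_partition n A" "(i, k) \<in> A"
  shows "1 \<le> i" "i < k" "k \<le> n"
  using assms by (auto simp: noncrossing_partition_def)

lemma noncrossing_eq:
  assumes "noncrossing_partition n A" "(i, k) \<in> A" "(p, q) \<in> A" "i \<le> p" "p < k" "k \<le> q"
  shows "p = i" "q = k"
  using assms unfolding noncrossing_partition_def by blast+

lemma noncrossing_right_unique: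
  assumes A: "noncrossing_partition n A" and arcs: "(i, k) \<in> A" "(j, k) \<in> A"
  shows "i = j"
  using noncrossing_eq[OF A arcs] noncrossing_eq[OF A arcs(2,1)] noncrossing_bounds[OF A arcs(1)]
    noncrossing_bounds[OF A arcs(2)] by (cases "i \<le> j") auto

lemma Q_perm_arc:
  assumes A: "noncrossing_partition n A" and arc: "(i, k) \<in> A"
  shows "Q_perm n A k = i"
proof -
  have "(THE j. (j, k) \<in> A) = i"
    using arc noncrossing_right_unique[OF A _ arc] by blast
  then show ?thesis
    using arc noncrossing_bounds[OF A arc] by (auto simp: Q_perm_def)
qed

text \<open>At most one arc enters a point, so a backward step from \<open>y\<close> merely retraces
  the last arc of the ascending path to \<open>y\<close>; from \<open>a\<close> itself there is no
  backward step.\<close>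

lemma component_of_minimum:
  assumes A: "noncrossing_partition n A" and a: "\<And>i. (i, a) \<notin> A"
    and k: "(a, k) \<in> (A \<union> A\<inverse>)\<^sup>*"
  shows "(a, k) \<in> A\<^sup>*"
  using k
proof (induction rule: rtrancl_induct)
  case (step y z)
  show ?case
  proof (cases "(y, z) \<in> A")
    case False
    then have zy: "(z, y) \<in> A" using step.hyps by auto
    then have "a \<noteq> y" using a by auto
    then obtain y' where y': "(a, y') \<in> A\<^sup>*" "(y', y) \<in> A"
      using step.IH by (auto elim: rtranclE)
    with zy show ?thesis using noncrossing_right_unique[OF A] by blast
  qed (use step.IH in auto)
qed simp

text \<open>A point without incoming arc opens its block, and its image closes it: an arc leaving
  the image would lead to a larger element of the component.\<close>

lemma Q_perm_minimum:
  assumes A: "noncrossing_partition n A" and a: "a \<in> {1..n}" "\<And>i. (i, a) \<notin> A"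
  shows "(a, Q_perm n A a) \<in> A\<^sup>*" and "Q_perm n A a \<in> {a..n}"
    and "\<And>q. (Q_perm n A a, q) \<notin> A"
proof -
  let ?C = "arc_component n A a" and ?m = "Q_perm n A a"
  have C: "finite ?C" "a \<in> ?C" using a by (auto simp: arc_component_def)
  have m: "?m = Max ?C" using a by (simp add: Q_perm_def)
  have "?m \<in> ?C" unfolding m using C by (intro Max_in) auto
  then show am: "(a, ?m) \<in> A\<^sup>*"
    using component_of_minimum[OF A a(2)] by (auto simp: arc_component_def)
  show "?m \<in> {a..n}"
    using \<open>?m \<in> ?C\<close> Max_ge[OF C] m by (auto simp: arc_component_def)
  show "(?m, q) \<notin> A" for q
  proof
    assume q: "(?m, q) \<in> A"
    have "(a, ?m) \<in> (A \<union> A\<inverse>)\<^sup>*"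
      using \<open>?m \<in> ?C\<close> by (auto simp: arc_component_def)
    then have "(a, q) \<in> (A \<union> A\<inverse>)\<^sup>*"
      using q by (meson UnI1 rtrancl.rtrancl_into_rtrancl)
    then have "q \<in> ?C" using noncrossing_bounds[OF A q] by (auto simp: arc_component_def)
    then show False using Max_ge[OF C(1), of q] m noncrossing_bounds[OF A q] by simp
  qed
qed

text \<open>Exactly the right endpoints are moved strictly down, and there the value names the arc;
  all other points move weakly up. So the arcs can be read off.\<close>

lemma Q_perm_inj: "inj_on (Q_perm n) {A. noncrossing_partition n A}"
proof (rule inj_on_inverseI)
  fix A assume "A \<in> {A. noncrossing_partition n A}"
  then have A: "noncrossing_partition n A" by simp
  show "{(Q_perm n A j, j) | j. j \<in> {1..n} \<and> Q_perm n A j < j} = A"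
  proof (intro subset_antisym subsetI)
    fix x assume "x \<in> {(Q_perm n A j, j) | j. j \<in> {1..n} \<and> Q_perm n A j < j}"
    then obtain j where j: "x = (Q_perm n A j, j)" "j \<in> {1..n}" "Q_perm n A j < j" by auto
    then obtain i where "(i, j) \<in> A"
      using Q_perm_minimum(2)[OF A, of j] by force
    then show "x \<in> A" using Q_perm_arc[OF A] j by simp
  next
    fix x assume "x \<in> A"
    then show "x \<in> {(Q_perm n A j, j) | j. j \<in> {1..n} \<and> Q_perm n A j < j}"
      using Q_perm_arc[OF A, of "fst x" "snd x"] noncrossing_bounds[OF A, of "fst x" "snd x"]
      by (cases x) force
  qed
qed

lemma finite_noncrossing: "finite {A. noncrossing_partition n A}"
proof (rule finite_subset)
  show "{A. noncrossing_partition n A} \<subseteq> Pow ({1..n} \<times> {1..n})"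
    by (force simp: noncrossing_partition_def)
qed simp

lemma QSV_eq_image: "QSV n = Q_perm n ` {A. noncrossing_partition n A}"
  by (auto simp: QSV_def)

lemma finite_QSV: "finite (QSV n)"
  by (simp add: QSV_eq_image finite_noncrossing)

lemma card_QSV: "card (QSV n) = card {A. noncrossing_partition n A}"
  by (simp add: QSV_eq_image card_image Q_perm_inj)

section \<open>Telescoping along a noncrossing partition\<close>

definition interval_comp :: "(nat \<Rightarrow> 'a \<Rightarrow> 'a) \<Rightarrow> nat \<Rightarrow> nat \<Rightarrow> 'a \<Rightarrow> 'a" where
  "interval_comp f a b = foldr (\<lambda>j. (\<circ>) (f j)) [a..<b] id"

lemma interval_comp_empty: "b \<le> a \<Longrightarrow> interval_comp f a b = id"
  by (simp add: interval_comp_def)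

lemma interval_comp_Cons: "a < b \<Longrightarrow> interval_comp f a b = f a \<circ> interval_comp f (Suc a) b"
  by (simp add: interval_comp_def upt_conv_Cons)

lemma interval_comp_split:
  "a \<le> b \<Longrightarrow> b \<le> c \<Longrightarrow> interval_comp f a c = interval_comp f a b \<circ> interval_comp f b c"
proof (induction a rule: inc_induct)
  case base
  then show ?case by (simp add: interval_comp_empty)
next
  case (step a)
  then show ?case by (simp add: interval_comp_Cons comp_assoc)
qed

text \<open>The intervals that are unions of blocks, over which the product cancels on its
  own.\<close>

definition closed_interval :: "(nat \<times> nat) set \<Rightarrow> nat \<Rightarrow> nat \<Rightarrow> bool" where
  "closed_interval A a b \<longleftrightarrow> (\<forall>(i, j) \<in> A. i \<in> {a..<b} \<longleftrightarrow> j \<in> {a..<b})"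

text \<open>An arc with exactly one end strictly under \<open>(i, k)\<close> would start inside and
  end at \<open>k\<close> or beyond, or start at \<open>i\<close> or before and end inside; both are
  crossings.\<close>

lemma closed_interval_arc:
  assumes A: "noncrossing_partition n A" and ik: "(i, k) \<in> A"
  shows "closed_interval A (Suc i) k"
proof -
  have "p \<in> {Suc i..<k} \<longleftrightarrow> q \<in> {Suc i..<k}" if pq: "(p, q) \<in> A" for p q
  proof -
    have "q < k" if "i < p" "p < k"
      using noncrossing_eq(1)[OF A ik pq] that by (cases "k \<le> q") simp_all
    moreover have "i < p" if "i < q" "q < k"
      using noncrossing_eq(2)[OF A pq ik] that by (cases "p \<le> i") simp_all
    ultimately show ?thesis
      using noncrossing_bounds(2)[OF A pq] by auto
  qed
  then show ?thesis by (auto simp: closed_interval_def)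
qed

lemma chain_mono:
  assumes A: "noncrossing_partition n A" and "(i, m) \<in> A\<^sup>*"
  shows "i \<le> m"
  using assms(2) noncrossing_bounds(2)[OF A]
  by (induction rule: rtrancl_induct) force+

text \<open>Follow the chain to its arc that spans \<open>p\<close>; noncrossing keeps
  \<open>q\<close> within that arc. So nothing that starts before the end of a block jumps over
  it.\<close>

lemma under_chain:
  assumes A: "noncrossing_partition n A" and im: "(i, m) \<in> A\<^sup>*"
    and pq: "(p, q) \<in> A" "i \<le> p" "p < m"
  shows "q \<le> m"
  using im pq(2)
proof (induction rule: converse_rtrancl_induct)
  case base
  then show ?case using pq(3) by simp
next
  case (step i k)
  show ?case
  proof (cases "k \<le> p")
    case False
    then have "q \<le> k"
      using noncrossing_eq(2)[OF A step.hyps(1) pq(1)] step.prems by (cases "k \<le> q") auto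
    also have "k \<le> m" using chain_mono[OF A step.hyps(2)] .
    finally show ?thesis .
  qed (use step.IH in simp)
qed

text \<open>In group terms this is \<open>\<Prod>\<^sub>j g(\<sigma>(j)) g(j)\<^sup>-\<^sup>1 = 1\<close>, which holds in the free group: the
  factors of each block telescope once everything nested between them has cancelled.\<close>

lemma interval_comp_closed:
  assumes A: "noncrossing_partition n A"
    and gh: "\<And>j. g j \<circ> h j = id" "\<And>j. h j \<circ> g j = id"
    and "closed_interval A a b" "1 \<le> a" "b \<le> Suc n"
  shows "interval_comp (\<lambda>j. g (Q_perm n A j) \<circ> h j) a b = id"
  using assms(4-6)
proof (induction "b - a" arbitrary: a b rule: less_induct)
  case less
  let ?c = "\<lambda>j. g (Q_perm n A j) \<circ> h j"
  show ?case
  proof (cases "a < b")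
    case False
    then show ?thesis by (simp add: interval_comp_empty)
  next
    case True
    \<comment> \<open>An arc into \<open>a\<close> would start outside the interval, so
      \<open>a\<close> opens its block.\<close>
    have no_arc: "(i, a) \<notin> A" for i
      using less.prems(1) True noncrossing_bounds(2)[OF A, of i a]
      by (fastforce simp: closed_interval_def)
    let ?m = "Q_perm n A a"
    have a: "a \<in> {1..n}" using True less.prems by simp
    note m = Q_perm_minimum[OF A a no_arc]
    have chain_closed: "k \<in> {a..<b}" if "(a, k) \<in> A\<^sup>*" for k
      using that
    proof (induction rule: rtrancl_induct)
      case (step y z)
      then show ?case using less.prems(1) by (auto simp: closed_interval_def)
    qed (use True in simp)
    have mb: "?m < b" using chain_closed[OF m(1)] by simp
    \<comment> \<open>Backwards along the chain: for an arc \<open>(i, k)\<close> the points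
      strictly between contribute \<open>id\<close> by the outer induction, and the factor
      \<open>g i \<circ> h k\<close> cancels against the \<open>g k\<close> that starts the
      rest.\<close>
    have chain: "interval_comp ?c (Suc i) (Suc ?m) = g i \<circ> h ?m"
      if "(i, ?m) \<in> A\<^sup>*" "a \<le> i" for i
      using that
    proof (induction rule: converse_rtrancl_induct)
      case base
      then show ?case by (simp add: interval_comp_empty gh)
    next
      case (step i k)
      have ik: "1 \<le> i" "i < k" "k \<le> n" using noncrossing_bounds[OF A step.hyps(1)] by auto
      have km: "k \<le> ?m" using chain_mono[OF A step.hyps(2)] .
      have "interval_comp ?c (Suc i) k = id"
        using ik km mb step.prems True
        by (intro less.hyps closed_interval_arc[OF A step.hyps(1)]) auto
      moreover have "interval_comp ?c (Suc k) (Suc ?m) = g k \<circ> h ?m"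
        by (rule step.IH) (use step.prems ik in simp)
      then have "interval_comp ?c k (Suc ?m) = ?c k \<circ> (g k \<circ> h ?m)"
        using interval_comp_Cons[of k "Suc ?m" ?c] km by (simp only: less_Suc_eq_le)
      moreover have "interval_comp ?c (Suc i) (Suc ?m)
          = interval_comp ?c (Suc i) k \<circ> interval_comp ?c k (Suc ?m)"
        using ik km by (intro interval_comp_split) auto
      ultimately show ?case
        using Q_perm_arc[OF A step.hyps(1)] gh by (metis comp_assoc comp_id id_comp)
    qed
    \<comment> \<open>No arc leaves \<open>?m\<close>, and those starting earlier in the interval
      stop at or before \<open>?m\<close>, so the remainder is again a union of blocks.\<close>
    have "closed_interval A (Suc ?m) b"
      unfolding closed_interval_def
    proof (intro ballI, clarify)
      fix p q assume pq: "(p, q) \<in> A"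
      then have "p \<in> {a..<b} \<longleftrightarrow> q \<in> {a..<b}"
        using less.prems(1) by (auto simp: closed_interval_def)
      moreover have "q \<le> ?m" if "a \<le> p" "p < ?m" using under_chain[OF A m(1) pq that] .
      moreover have "p \<noteq> ?m" using m(3) pq by auto
      moreover have "p < q" using noncrossing_bounds[OF A pq] by simp
      ultimately show "p \<in> {Suc ?m..<b} \<longleftrightarrow> q \<in> {Suc ?m..<b}"
        using m(2) by (cases "p < ?m") auto
    qed
    then have rest: "interval_comp ?c (Suc ?m) b = id"
      using less.prems m(2) True mb by (intro less.hyps) auto
    have "interval_comp ?c a b = ?c a \<circ> (interval_comp ?c (Suc a) (Suc ?m) \<circ> interval_comp ?c (Suc ?m) b)"
      using m(2) mb True interval_comp_split[of "Suc a" "Suc ?m" b ?c]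
      by (simp add: interval_comp_Cons)
    \<comment> \<open>The opener \<open>a\<close> contributes \<open>g ?m \<circ> h a\<close>, which
      closes the cycle of the block.\<close>
    also have "\<dots> = g ?m \<circ> h a \<circ> (g a \<circ> h ?m)"
      unfolding chain[OF m(1) order.refl] rest by simp
    also have "\<dots> = id" using gh by (metis comp_assoc comp_id)
    finally show ?thesis .
  qed
qed

corollary interval_comp_noncrossing:
  assumes A: "noncrossing_partition n A"
    and "\<And>j. g j \<circ> h j = id" "\<And>j. h j \<circ> g j = id"
  shows "interval_comp (\<lambda>j. g (Q_perm n A j) \<circ> h j) 1 (Suc n) = id"
  using noncrossing_bounds[OF A]
  by (intro interval_comp_closed[OF assms]) (force simp: closed_interval_def)+

text \<open>Scanning \<open>1, \<dots>, n\<close>, the stack holds the points that a later arc may still start from.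
  At \<open>j\<close>, \<open>\<nu> j\<close> points are popped, the last of them being joined to \<open>j\<close>, and \<open>j\<close> is pushed.\<close>

fun stack :: "(nat \<Rightarrow> nat) \<Rightarrow> nat \<Rightarrow> nat list" where
  "stack \<nu> 0 = []"
| "stack \<nu> (Suc j) = Suc j # drop (\<nu> (Suc j)) (stack \<nu> j)"

definition stack_arcs :: "nat \<Rightarrow> (nat \<Rightarrow> nat) \<Rightarrow> (nat \<times> nat) set" where
  "stack_arcs n \<nu> = {(stack \<nu> (k - 1) ! (\<nu> k - 1), k) | k. k \<in> {1..n} \<and> 0 < \<nu> k}"

lemma stack_bounds: "set (stack \<nu> k) \<subseteq> {1..k}"
  by (induction k) (auto dest!: in_set_dropD)

lemma stack_sorted: "sorted_wrt (>) (stack \<nu> k)"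
proof (induction k)
  case (Suc k)
  then show ?case
    using stack_bounds[of \<nu> k] by (auto simp: sorted_wrt_drop dest!: in_set_dropD)
qed simp

lemma stack_distinct: "distinct (stack \<nu> k)"
  using stack_sorted[of \<nu> k] by (induction "stack \<nu> k") (auto simp: sorted_wrt_iff_nth_less distinct_conv_nth nat_neq_iff)

text \<open>Each step pushes one point, and the ballot condition ensures that \<open>drop\<close>
  always finds as many points as it is to remove.\<close>

lemma stack_length:
  assumes "\<And>i. i \<in> {1..n} \<Longrightarrow> (\<Sum>j=1..i. \<nu> j) < i" "k \<le> n"
  shows "length (stack \<nu> k) + (\<Sum>j=1..k. \<nu> j) = k"
  using assms(2)
proof (induction k)
  case (Suc k)
  have "(\<Sum>j=1..Suc k. \<nu> j) < Suc k" using Suc.prems by (intro assms(1)) auto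
  with Suc show ?case by auto
qed simp

lemma pop_le_stack_length:
  assumes "\<And>i. i \<in> {1..n} \<Longrightarrow> (\<Sum>j=1..i. \<nu> j) < i" "k \<in> {1..n}"
  shows "\<nu> k \<le> length (stack \<nu> (k - 1))"
proof -
  obtain j where j: "k = Suc j" using assms(2) by (cases k) auto
  then show ?thesis
    using stack_length[of n \<nu> j] assms(1)[OF assms(2)] assms by auto
qed

text \<open>A point is pushed only at its own time, so once popped it never returns.\<close>

lemma stack_persist:
  assumes "k \<le> m" "x \<in> set (stack \<nu> m)" "x \<le> k"
  shows "x \<in> set (stack \<nu> k)"
  using assms
  by (induction m rule: dec_induct) (auto dest: in_set_dropD)

text \<open>In a crossing, \<open>j\<close> is still on the stack just before \<open>l\<close>, so
  it survived the pops at \<open>k\<close>. It then lies deeper than \<open>i\<close>, the last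
  point popped there, and the stack decreases with depth, so \<open>j < i\<close>.\<close>

lemma noncrossing_stack_arcs:
  assumes \<nu>: "\<And>i. i \<in> {1..n} \<Longrightarrow> (\<Sum>j=1..i. \<nu> j) < i"
  shows "noncrossing_partition n (stack_arcs n \<nu>)"
proof -
  have arc: "k \<in> {1..n} \<and> 0 < \<nu> k \<and> \<nu> k - 1 < length (stack \<nu> (k - 1)) \<and>
      i = stack \<nu> (k - 1) ! (\<nu> k - 1) \<and> i \<in> set (stack \<nu> (k - 1))"
    if "(i, k) \<in> stack_arcs n \<nu>" for i k
    using that pop_le_stack_length[of n \<nu> k, OF \<nu>] by (auto simp: stack_arcs_def)
  show ?thesis
    unfolding noncrossing_partition_def
  proof (intro conjI ballI notI, clarify)
    fix i k assume "(i, k) \<in> stack_arcs n \<nu>"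
    from arc[OF this] stack_bounds[of \<nu> "k - 1"] have "i \<in> {1..k - 1}" "k \<in> {1..n}" by auto
    then show "1 \<le> i \<and> i < k \<and> k \<le> n" by auto
  next
    assume "\<exists>i j k l. (i, k) \<in> stack_arcs n \<nu> \<and> (j, l) \<in> stack_arcs n \<nu> \<and> (i, k) \<noteq> (j, l) \<and>
      i \<le> j \<and> j < k \<and> k \<le> l"
    then obtain i j k l where ik: "(i, k) \<in> stack_arcs n \<nu>" and jl: "(j, l) \<in> stack_arcs n \<nu>"
      and ne: "(i, k) \<noteq> (j, l)" and le: "i \<le> j" "j < k" "k \<le> l" by blast
    have "k \<noteq> l" using arc[OF ik] arc[OF jl] ne by auto
    then have "j \<in> set (stack \<nu> k)"
      using arc[OF jl] le by (intro stack_persist[of k "l - 1"]) auto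
    moreover obtain k' where k': "k = Suc k'" using le by (cases k) auto
    ultimately have "j \<in> set (drop (\<nu> k) (stack \<nu> k'))" using le by auto
    then obtain t where t: "\<nu> k + t < length (stack \<nu> k')" "j = stack \<nu> k' ! (\<nu> k + t)"
      by (auto simp: in_set_conv_nth less_diff_conv add.commute)
    have "stack \<nu> k' ! (\<nu> k + t) < stack \<nu> k' ! (\<nu> k - 1)"
      using arc[OF ik] t(1) by (intro sorted_wrt_nth_less[OF stack_sorted, rule_format]) auto
    then show False using arc[OF ik] k' t le by simp
  qed
qed

text \<open>As long as the stacks agree, the arc ending at the next point locates the last popped
  entry and thus the number of pops, entries being distinct; no arc means no pop.\<close>

lemma stack_arcs_inj:
  assumes \<nu>: "\<And>i. i \<in> {1..n} \<Longrightarrow> (\<Sum>j=1..i. \<nu> j) < i"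
    and \<nu>': "\<And>i. i \<in> {1..n} \<Longrightarrow> (\<Sum>j=1..i. \<nu>' j) < i"
    and eq: "stack_arcs n \<nu> = stack_arcs n \<nu>'" and k: "k \<in> {1..n}"
  shows "\<nu> k = \<nu>' k"
proof -
  have "(\<forall>j\<in>{1..k}. \<nu> j = \<nu>' j) \<and> stack \<nu> k = stack \<nu>' k" if "k \<le> n" for k
    using that
  proof (induction k)
    case (Suc k)
    then have IH: "\<forall>j\<in>{1..k}. \<nu> j = \<nu>' j" "stack \<nu> k = stack \<nu>' k" by auto
    have k: "Suc k \<in> {1..n}" using Suc.prems by simp
    have arc: "(i, Suc k) \<in> stack_arcs n \<mu> \<longleftrightarrow> 0 < \<mu> (Suc k) \<and> i = stack \<mu> k ! (\<mu> (Suc k) - 1)"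
      for i \<mu> using k by (auto simp: stack_arcs_def)
    have le: "\<nu> (Suc k) \<le> length (stack \<nu> k)" "\<nu>' (Suc k) \<le> length (stack \<nu> k)"
      using pop_le_stack_length[OF \<nu> k] pop_le_stack_length[OF \<nu>' k] IH by auto
    have iff: "0 < \<nu> (Suc k) \<and> i = stack \<nu> k ! (\<nu> (Suc k) - 1) \<longleftrightarrow>
        0 < \<nu>' (Suc k) \<and> i = stack \<nu> k ! (\<nu>' (Suc k) - 1)" for i
      using arc[of i \<nu>] arc[of i \<nu>'] eq IH(2) by simp
    have "\<nu> (Suc k) = \<nu>' (Suc k)"
    proof (cases "\<nu> (Suc k) = 0")
      case True
      then show ?thesis using iff by auto
    next
      case False
      with iff have pos: "0 < \<nu>' (Suc k)"
        and nth: "stack \<nu> k ! (\<nu> (Suc k) - 1) = stack \<nu> k ! (\<nu>' (Suc k) - 1)" by auto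
      then have "\<nu> (Suc k) - 1 = \<nu>' (Suc k) - 1"
        using False le nth_eq_iff_index_eq[OF stack_distinct, of "\<nu> (Suc k) - 1" \<nu> k "\<nu>' (Suc k) - 1"]
        by auto
      then show ?thesis using pos False by simp
    qed
    then show ?case using IH by (auto simp: le_Suc_eq)
  qed simp
  then show ?thesis using k by auto
qed


section \<open>Quasisymmetric polynomials and their vanishing deformations\<close>

text \<open>The action of \<open>1 + \<Sum>\<^sub>m x\<^sup>m z\<^sub>m\<close> and of its inverse on series in noncommuting variables
  \<open>z\<^sub>1, z\<^sub>2, \<dots>\<close>, a series being the family of its coefficients indexed by words.\<close>

fun mul_op :: "'a::comm_ring_1 \<Rightarrow> (nat list \<Rightarrow> 'a) \<Rightarrow> nat list \<Rightarrow> 'a" where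
  "mul_op x v [] = v []"
| "mul_op x v (a # \<alpha>) = v (a # \<alpha>) + x ^ a * v \<alpha>"

fun div_op :: "'a::comm_ring_1 \<Rightarrow> (nat list \<Rightarrow> 'a) \<Rightarrow> nat list \<Rightarrow> 'a" where
  "div_op x v [] = v []"
| "div_op x v (a # \<alpha>) = v (a # \<alpha>) - x ^ a * div_op x v \<alpha>"

lemma mul_op_div_op: "mul_op x \<circ> div_op x = id"
proof (intro ext)
  show "(mul_op x \<circ> div_op x) v \<alpha> = id v \<alpha>" for v \<alpha> by (cases \<alpha>) auto
qed

lemma div_op_mul_op: "div_op x \<circ> mul_op x = id"
proof (intro ext)
  show "(div_op x \<circ> mul_op x) v \<alpha> = id v \<alpha>" for v \<alpha> by (induction \<alpha>) auto
qed

primrec unit_vec :: "nat list \<Rightarrow> 'a::comm_ring_1" where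
  "unit_vec [] = 1"
| "unit_vec (a # \<alpha>) = 0"

text \<open>The product of the series \<open>1 + \<Sum>\<^sub>m x\<^sup>m z\<^sub>m\<close> over the
  listed variables; its coefficients are the M_\<alpha>.\<close>

primrec monomial_qs :: "nat list \<Rightarrow> nat list \<Rightarrow> mpoly" where
  "monomial_qs [] = unit_vec"
| "monomial_qs (x # xs) = mul_op (Var x) (monomial_qs xs)"

text \<open>The same product with each factor followed by the inverse series at the constant equal
  to the index of its variable.\<close>

primrec vanishing_qs :: "nat list \<Rightarrow> nat list \<Rightarrow> mpoly" where
  "vanishing_qs [] = unit_vec"
| "vanishing_qs (x # xs) = mul_op (Var x) (div_op (Const (of_nat x)) (vanishing_qs xs))"

lemma monomial_qs_Nil [simp]: "monomial_qs xs [] = 1"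
  by (induction xs) auto

lemma monomial_qs_eq_0: "length xs < length \<alpha> \<Longrightarrow> monomial_qs xs \<alpha> = 0"
proof (induction xs arbitrary: \<alpha>)
  case (Cons x xs)
  then show ?case by (cases \<alpha>) auto
qed (auto simp: neq_Nil_conv)

text \<open>Index sequences are split by whether they begin with \<open>s\<close>, which is the
  recursion of \<open>mul_op\<close>; the lower bound \<open>s\<close> is general for the sake of
  this induction.\<close>

lemma monomial_qsym_upt:
  assumes "s \<le> Suc n"
  shows "(\<Sum>js \<in> {js. length js = length \<alpha> \<and> sorted_wrt (<) js \<and> set js \<subseteq> {s..n}}.
      \<Prod>t<length \<alpha>. Var (js ! t) ^ (\<alpha> ! t)) = monomial_qs [s..<Suc n] \<alpha>"
  using assms
proof (induction s arbitrary: \<alpha> rule: inc_induct)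
  case base
  show ?case
  proof (cases \<alpha>)
    case (Cons a \<beta>)
    then have empty: "{js. length js = length \<alpha> \<and> sorted_wrt (<) js \<and> set js \<subseteq> {Suc n..n}} = {}"
      by auto
    show ?thesis unfolding empty by (simp add: Cons)
  qed (auto simp: conj_commute cong: conj_cong)
next
  case (step s)
  let ?S = "\<lambda>s \<alpha>. {js. length js = length \<alpha> \<and> sorted_wrt (<) js \<and> set js \<subseteq> {s..n}}"
  have fin: "finite (?S s \<alpha>)" for s \<alpha>
    by (rule finite_subset[OF _ finite_lists_length_eq[of "{s..n}" "length \<alpha>"]]) auto
  show ?case
  proof (cases \<alpha>)
    case Nil
    have "?S s [] = {[]}" by auto
    then show ?thesis using Nil by simp
  next
    case (Cons a \<beta>)
    let ?f = "\<lambda>js. \<Prod>t<length \<alpha>. Var (js ! t) ^ (\<alpha> ! t)"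
    have S: "?S s \<alpha> = ?S (Suc s) \<alpha> \<union> Cons s ` ?S (Suc s) \<beta>"
    proof (intro subset_antisym subsetI)
      fix js assume js: "js \<in> ?S s \<alpha>"
      then obtain j js' where j: "js = j # js'" using Cons by (cases js) auto
      show "js \<in> ?S (Suc s) \<alpha> \<union> Cons s ` ?S (Suc s) \<beta>"
      proof (cases "j = s")
        case True
        then have "js' \<in> ?S (Suc s) \<beta>" using js j Cons by fastforce
        then show ?thesis using j True by simp
      next
        case False
        then show ?thesis using js j by fastforce
      qed
    next
      fix js assume "js \<in> ?S (Suc s) \<alpha> \<union> Cons s ` ?S (Suc s) \<beta>"
      then show "js \<in> ?S s \<alpha>" using step.hyps Cons by fastforce
    qed
    have "sum ?f (?S s \<alpha>) = sum ?f (?S (Suc s) \<alpha>) + sum ?f (Cons s ` ?S (Suc s) \<beta>)"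
      unfolding S by (intro sum.union_disjoint fin finite_imageI) auto
    also have "sum ?f (Cons s ` ?S (Suc s) \<beta>) = Var s ^ a * monomial_qs [Suc s..<Suc n] \<beta>"
      unfolding step.IH[symmetric]
      by (simp add: Cons sum.reindex sum_distrib_left prod.lessThan_Suc_shift del: prod.lessThan_Suc)
    also have "sum ?f (?S (Suc s) \<alpha>) + \<dots> = monomial_qs (s # [Suc s..<Suc n]) \<alpha>"
      unfolding step.IH by (simp add: Cons del: upt_Suc)
    also have "s # [Suc s..<Suc n] = [s..<Suc n]" using step.hyps by (simp add: upt_rec)
    finally show ?thesis .
  qed
qed

lemma monomial_qsym_eq: "monomial_qsym n \<alpha> = monomial_qs [1..<Suc n] \<alpha>"
  unfolding monomial_qsym_def by (rule monomial_qsym_upt) simp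

text \<open>The compositions refining the one encoded by \<open>w\<close>. The first unit of a part
  larger than one either becomes a part of its own or is merged into the part that follows
  it.\<close>

fun refinements :: "nat list \<Rightarrow> nat list list" where
  "refinements [] = [[]]"
| "refinements (0 # w) = map ((#) 1) (refinements w)"
| "refinements (Suc k # w) = map ((#) 1) (refinements (k # w)) @
     map (\<lambda>\<beta>. Suc (hd \<beta>) # tl \<beta>) (refinements (k # w))"

lemma refinements_composition:
  assumes "\<beta> \<in> set (refinements w)"
  shows "composition \<beta>" "\<beta> = [] \<longleftrightarrow> w = []"
  using assms
  by (induction w arbitrary: \<beta> rule: refinements.induct)
    (auto simp: composition_def, metis list.set_sel(2))

text \<open>The classical expansion of a fundamental quasisymmetric polynomial into monomial ones;
  both sides obey the same recursion.\<close>

lemma fundamental_refinements: "fundamental xs w = (\<Sum>\<beta>\<leftarrow>refinements w. monomial_qs xs \<beta>)"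
proof (induction xs w rule: fundamental.induct)
  case (2 k w)
  have "monomial_qs [] \<beta> = 0" if "\<beta> \<in> set (refinements (k # w))" for \<beta>
    using refinements_composition(2)[OF that] by (auto simp: neq_Nil_conv)
  then have "(\<Sum>\<beta>\<leftarrow>refinements (k # w). monomial_qs [] \<beta>) = (\<Sum>\<beta>\<leftarrow>refinements (k # w). 0)"
    by (intro arg_cong[of _ _ sum_list] map_cong refl)
  then show ?case by (simp only: fundamental.simps sum_list_0)
next
  case (4 x xs k w)
  \<comment> \<open>The two summands are what \<open>x\<close> adds to the polynomials of the two
    refinements made from \<open>\<beta>\<close>: a new part 1 in front, or the first part
    increased.\<close>
  have "Var x * monomial_qs (x # xs) \<beta> = Var x * monomial_qs xs \<beta> + Var x ^ Suc (hd \<beta>) * monomial_qs xs (tl \<beta>)"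
    if "\<beta> \<in> set (refinements (k # w))" for \<beta>
    using refinements_composition(2)[OF that] by (cases \<beta>) (auto simp: algebra_simps)
  then have "(\<Sum>\<beta>\<leftarrow>refinements (k # w). Var x * monomial_qs (x # xs) \<beta>) =
      (\<Sum>\<beta>\<leftarrow>refinements (k # w). Var x * monomial_qs xs \<beta> + Var x ^ Suc (hd \<beta>) * monomial_qs xs (tl \<beta>))"
    by (intro arg_cong[of _ _ sum_list] map_cong refl)
  with 4 show ?case
    by (simp add: sum_list_addf comp_def algebra_simps flip: sum_list_const_mult)
qed (auto simp: sum_list_addf comp_def sum_list_const_mult)

lemma fundamental_in_qsym_plus:
  assumes "w \<noteq> []"
  shows "fundamental [1..<Suc n] w \<in> qsym_plus n"
proof -
  have "monomial_qs [1..<Suc n] \<beta> \<in> qsym_plus n" if "\<beta> \<in> set (refinements w)" for \<beta>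
  proof (cases "length \<beta> \<le> n")
    case True
    then show ?thesis
      unfolding qsym_plus_def monomial_qsym_eq[symmetric]
      using refinements_composition[OF that] assms by (intro mpoly.span_base) auto
  next
    case False
    \<comment> \<open>Refinements may have more than \<open>n\<close> parts; their polynomials
      vanish for lack of variables.\<close>
    then have "monomial_qs [1..<Suc n] \<beta> = 0" by (intro monomial_qs_eq_0) (simp del: upt_Suc)
    then show ?thesis by (simp add: qsym_plus_def mpoly.span_zero del: upt_Suc)
  qed
  then show ?thesis
    unfolding fundamental_refinements sum_list_sum_nth qsym_plus_def
    by (intro mpoly.span_sum) (simp del: upt_Suc)
qed

section \<open>Degree bounds and leading terms\<close>

definition deg_lt :: "nat \<Rightarrow> nat \<Rightarrow> mpoly \<Rightarrow> bool" where
  "deg_lt n d p \<longleftrightarrow> (\<forall>m \<in> Poly_Mapping.keys p. mdeg n m < d)"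

text \<open>Because the bound is strict, inductions on it start from the zero polynomial.\<close>

lemma deg_lt_0_iff: "deg_lt n 0 p \<longleftrightarrow> p = 0"
  by (simp add: deg_lt_def flip: keys_eq_empty)

lemma deg_lt_zero [simp]: "deg_lt n d 0"
  by (simp add: deg_lt_def)

lemma deg_lt_mono: "deg_lt n d p \<Longrightarrow> d \<le> e \<Longrightarrow> deg_lt n e p"
  by (auto simp: deg_lt_def)

lemma deg_lt_add: "deg_lt n d p \<Longrightarrow> deg_lt n d q \<Longrightarrow> deg_lt n d (p + q)"
  using Poly_Mapping.keys_add[of p q] by (auto simp: deg_lt_def)

lemma deg_lt_diff: "deg_lt n d p \<Longrightarrow> deg_lt n d q \<Longrightarrow> deg_lt n d (p - q)"
  using keys_diff[of p q] by (auto simp: deg_lt_def)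

lemma deg_lt_single_mult: "deg_lt n d p \<Longrightarrow> deg_lt n (mdeg n m + d) (Poly_Mapping.single m c * p)"
  using keys_mult[of "Poly_Mapping.single m c" p]
  by (auto simp: deg_lt_def mdeg_add split: if_splits)

lemma Const_power: "Const c ^ k = Const (c ^ k)"
  by (induction k) (auto simp: Const_1 Const_mult)

lemma deg_lt_Const_mult: "deg_lt n d p \<Longrightarrow> deg_lt n d (Const c ^ k * p)"
  using deg_lt_single_mult[of n d p 0] by (simp add: Const_power) (simp add: Const_def)

lemma deg_lt_scale: "deg_lt n d p \<Longrightarrow> deg_lt n d (mpoly_scale c p)"
  using deg_lt_Const_mult[of n d p c 1] by (simp add: mpoly_scale_def)

lemma deg_lt_Var_mult: "x \<in> {1..n} \<Longrightarrow> deg_lt n d p \<Longrightarrow> deg_lt n (k + d) (Var x ^ k * p)"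
  using deg_lt_single_mult[of n d p "Poly_Mapping.single x k"] by (simp add: Var_power mdeg_single)

lemma hom_polys_keys:
  assumes "p \<in> hom_polys n s d" "m \<in> Poly_Mapping.keys p"
  shows "Poly_Mapping.keys m \<subseteq> {s..n}" "mdeg n m = d"
proof -
  let ?P = "\<lambda>p. \<forall>m \<in> Poly_Mapping.keys p. Poly_Mapping.keys m \<subseteq> {s..n} \<and> mdeg n m = d"
  have "?P p"
    using assms(1) unfolding hom_polys_def
  proof (induction p rule: mpoly.span_induct_alt)
    case (step c x y)
    have "Poly_Mapping.keys (mpoly_scale c x + y) \<subseteq> Poly_Mapping.keys x \<union> Poly_Mapping.keys y"
      using Poly_Mapping.keys_add[of "mpoly_scale c x" y] step.hyps(1)
      by (auto simp flip: single_eq_scale split: if_splits)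
    then show ?case using step by fastforce
  qed simp
  then show "Poly_Mapping.keys m \<subseteq> {s..n}" "mdeg n m = d" using assms(2) by auto
qed

lemma monomial_qs_hom:
  assumes "set xs \<subseteq> {s..n}" "1 \<le> s"
  shows "monomial_qs xs \<alpha> \<in> hom_polys n s (sum_list \<alpha>)"
proof -
  have one: "1 \<in> hom_polys n s 0"
    unfolding hom_polys_def by (intro mpoly.span_base image_eqI[where x = 0]) auto
  show ?thesis using assms(1)
  proof (induction xs arbitrary: \<alpha>)
    case Nil
    with one show ?case by (cases \<alpha>) (auto simp: hom_polys_def mpoly.span_zero)
  next
    case (Cons x xs)
    have pow: "Var x ^ k * p \<in> hom_polys n s (k + d)" if "p \<in> hom_polys n s d" for k p d
      using that Cons.prems assms(2)
      by (induction k) (auto simp: mult.assoc hom_polys_Var)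
    show ?case
    proof (cases \<alpha>)
      case (Cons a \<beta>)
      then show ?thesis
        using Cons.IH[of \<alpha>] pow[OF Cons.IH[of \<beta>]] Cons.prems
        by (simp add: hom_polys_def mpoly.span_add)
    qed (use one in simp)
  qed
qed

lemma deg_lt_monomial_qs:
  assumes "set xs \<subseteq> {1..n}"
  shows "deg_lt n (Suc (sum_list \<alpha>)) (monomial_qs xs \<alpha>)"
  using hom_polys_keys(2)[OF monomial_qs_hom[OF assms]] by (auto simp: deg_lt_def)

lemma mul_op_carrier:
  assumes "p \<in> mpoly_carrier n" "\<And>\<alpha>. v \<alpha> \<in> mpoly_carrier n"
  shows "mul_op p v \<alpha> \<in> mpoly_carrier n"
proof -
  have "p ^ k \<in> mpoly_carrier n" for k
    by (induction k) (simp_all add: mpoly_carrier_closed assms)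
  then show ?thesis by (cases \<alpha>) (simp_all add: mpoly_carrier_closed assms)
qed

lemma mpoly_carrier_diff: "p \<in> mpoly_carrier n \<Longrightarrow> q \<in> mpoly_carrier n \<Longrightarrow> p - q \<in> mpoly_carrier n"
  using mpoly_carrier_closed(5,6)[of _ n] by (metis diff_conv_add_uminus)

lemma div_op_carrier:
  assumes "p \<in> mpoly_carrier n" "\<And>\<alpha>. v \<alpha> \<in> mpoly_carrier n"
  shows "div_op p v \<alpha> \<in> mpoly_carrier n"
proof -
  have "p ^ k \<in> mpoly_carrier n" for k
    by (induction k) (simp_all add: mpoly_carrier_closed assms)
  then show ?thesis
    by (induction \<alpha>) (simp_all add: mpoly_carrier_closed assms mpoly_carrier_diff)
qed

lemma vanishing_qs_carrier: "set xs \<subseteq> {1..n} \<Longrightarrow> vanishing_qs xs \<alpha> \<in> mpoly_carrier n"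
proof (induction xs arbitrary: \<alpha>)
  case Nil
  then show ?case by (cases \<alpha>) (simp_all add: mpoly_carrier_closed)
next
  case (Cons x xs)
  then show ?case by (simp add: mul_op_carrier div_op_carrier mpoly_carrier_closed)
qed

text \<open>The correction terms carry powers of constants in place of powers of variables, and all parts
  of a composition are positive.\<close>

lemma vanishing_qs_leading:
  assumes "set xs \<subseteq> {1..n}" "composition \<alpha>"
  shows "deg_lt n (sum_list \<alpha>) (vanishing_qs xs \<alpha> - monomial_qs xs \<alpha>)"
  using assms
proof (induction xs arbitrary: \<alpha>)
  case (Cons x xs)
  note IH = Cons.IH and xs = Cons.prems(1)
  let ?d = "div_op (Const (of_nat x)) (vanishing_qs xs)" and ?m = "monomial_qs xs"
  have d: "deg_lt n (sum_list \<alpha>) (?d \<alpha> - ?m \<alpha>)" if "composition \<alpha>" for \<alpha>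
    using that
  proof (induction \<alpha>)
    case Nil
    then show ?case using IH[of "[]"] xs by (simp add: composition_def)
  next
    case (Cons a \<alpha>)
    then have "deg_lt n (Suc (sum_list \<alpha>)) (?d \<alpha> - ?m \<alpha>)" "composition \<alpha>" "0 < a"
      by (auto simp: composition_def intro: deg_lt_mono)
    then have "deg_lt n (Suc (sum_list \<alpha>)) ((?d \<alpha> - ?m \<alpha>) + ?m \<alpha>)"
      using xs by (intro deg_lt_add deg_lt_monomial_qs) auto
    then have "deg_lt n (a + sum_list \<alpha>) (Const (of_nat x) ^ a * ?d \<alpha>)"
      using \<open>0 < a\<close> by (intro deg_lt_Const_mult) (auto intro: deg_lt_mono)
    moreover have "deg_lt n (a + sum_list \<alpha>) (vanishing_qs xs (a # \<alpha>) - ?m (a # \<alpha>))"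
      using xs Cons.prems IH[of "a # \<alpha>"] by simp
    ultimately show ?case
      using deg_lt_diff by (fastforce simp: algebra_simps)
  qed
  show ?case
  proof (cases \<alpha>)
    case Nil
    then show ?thesis using d[of "[]"] Cons.prems by simp
  next
    case (Cons a \<beta>)
    have "mul_op (Var x) ?d \<alpha> - mul_op (Var x) ?m \<alpha> = (?d \<alpha> - ?m \<alpha>) + Var x ^ a * (?d \<beta> - ?m \<beta>)"
      by (simp add: Cons algebra_simps)
    moreover have "deg_lt n (sum_list \<alpha>) (Var x ^ a * (?d \<beta> - ?m \<beta>))"
      using deg_lt_Var_mult[OF _ d, of x \<beta> a] Cons.prems Cons by (auto simp: composition_def)
    ultimately show ?thesis using d[OF Cons.prems(2)] by (simp add: deg_lt_add)
  qed
qed simp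

section \<open>Values on the quasisymmetric variety\<close>

lemma mpoly_eval_0 [simp]: "mpoly_eval 0 v = 0"
  by (simp add: mpoly_eval_def)

lemma mpoly_eval_1 [simp]: "mpoly_eval 1 v = 1"
  by (simp add: mpoly_eval_def)

lemma mpoly_eval_Const [simp]: "mpoly_eval (Const c) v = c"
  by (simp add: Const_def mpoly_eval_single)

lemma mpoly_eval_Var [simp]: "mpoly_eval (Var i) v = v i"
  by (simp add: Var_def mpoly_eval_single)

lemma mpoly_eval_diff: "mpoly_eval (p - q) v = mpoly_eval p v - mpoly_eval q v"
  using mpoly_eval_add[of "p - q" q v] by simp

lemma mpoly_eval_power: "mpoly_eval (p ^ k) v = mpoly_eval p v ^ k"
  by (induction k) (simp_all add: mpoly_eval_mult)

lemma mpoly_eval_mul_op: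
  "mpoly_eval (mul_op p f \<alpha>) v = mul_op (mpoly_eval p v) (\<lambda>\<beta>. mpoly_eval (f \<beta>) v) \<alpha>"
  by (cases \<alpha>) (simp_all add: mpoly_eval_add mpoly_eval_mult mpoly_eval_power)

lemma mpoly_eval_div_op:
  "mpoly_eval (div_op p f \<alpha>) v = div_op (mpoly_eval p v) (\<lambda>\<beta>. mpoly_eval (f \<beta>) v) \<alpha>"
  by (induction \<alpha>) (simp_all add: mpoly_eval_diff mpoly_eval_mult mpoly_eval_power)

text \<open>Evaluation is a ring homomorphism and so commutes with \<open>mul_op\<close> and
  \<open>div_op\<close>; the values become the telescoping product applied to the series 1.\<close>

lemma mpoly_eval_vanishing_qs:
  assumes "a \<le> b"
  shows "(\<lambda>\<alpha>. mpoly_eval (vanishing_qs [a..<b] \<alpha>) v) =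
     interval_comp (\<lambda>j. mul_op (v j) \<circ> div_op (of_nat j)) a b unit_vec"
  using assms
proof (induction a rule: inc_induct)
  case base
  show ?case
  proof
    show "mpoly_eval (vanishing_qs [b..<b] \<alpha>) v =
        interval_comp (\<lambda>j. mul_op (v j) \<circ> div_op (of_nat j)) b b unit_vec \<alpha>" for \<alpha>
      by (cases \<alpha>) (simp_all add: interval_comp_empty)
  qed
next
  case (step a)
  then show ?case
    by (simp add: upt_conv_Cons interval_comp_Cons mpoly_eval_mul_op mpoly_eval_div_op)
qed

text \<open>At a point of \<open>QSV n\<close> the composite is the identity, so the value is the
  coefficient of the series 1 at a non-empty word.\<close>

lemma vanishing_qs_in_vanishing_ideal:
  assumes "\<alpha> \<noteq> []"
  shows "vanishing_qs [1..<Suc n] \<alpha> \<in> vanishing_ideal n (QSV n)"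
proof -
  have "mpoly_eval (vanishing_qs [1..<Suc n] \<alpha>) (\<lambda>i. of_nat (Q_perm n A i)) = 0"
    if A: "noncrossing_partition n A" for A
    using interval_comp_noncrossing[OF A, of "\<lambda>j. mul_op (of_nat j :: rat)" "\<lambda>j. div_op (of_nat j)"] assms
      fun_cong[OF mpoly_eval_vanishing_qs[of 1 "Suc n" "\<lambda>i. of_nat (Q_perm n A i)"], of \<alpha>]
    by (cases \<alpha>) (simp_all add: mul_op_div_op div_op_mul_op del: upt_Suc)
  moreover have "vanishing_qs [1..<Suc n] \<alpha> \<in> mpoly_carrier n"
    by (rule vanishing_qs_carrier) auto
  ultimately show ?thesis by (auto simp: vanishing_ideal_def QSV_def mpoly_ring_simps)
qed


section \<open>Spanning by ballot monomials\<close>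

lemma ideal_mult_closed:
  assumes "ideal I (mpoly_ring n)" "p \<in> I" "q \<in> mpoly_carrier n"
  shows "q * p \<in> I"
  using ideal.I_l_closed[OF assms(1,2), of q] assms(3) by (simp add: mpoly_ring_simps)

lemma ideal_subspace:
  assumes "ideal I (mpoly_ring n)"
  shows "mpoly.subspace I"
proof -
  interpret I: additive_subgroup I "mpoly_ring n" by (rule ideal.axioms(1)[OF assms])
  show ?thesis
    unfolding mpoly.subspace_def mpoly_scale_def
    using I.zero_closed I.a_closed ideal_mult_closed[OF assms] mpoly_carrier_closed(3)
    by (auto simp: mpoly_ring_simps)
qed

lemma ideal_subset_carrier: "ideal I (mpoly_ring n) \<Longrightarrow> I \<subseteq> mpoly_carrier n"
  using additive_subgroup.a_subset[OF ideal.axioms(1)] by (force simp: mpoly_ring_simps)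

lemma mon_carrier: "mon m \<in> mpoly_carrier n \<longleftrightarrow> Poly_Mapping.keys m \<subseteq> {1..n}"
  by (simp add: mpoly_carrier_def)

lemma carrier_subspace: "mpoly.subspace (mpoly_carrier n)"
  by (simp add: mpoly.subspace_def mpoly_scale_def mpoly_carrier_closed)

definition ballot_span :: "nat \<Rightarrow> nat \<Rightarrow> mpoly set" where
  "ballot_span n d = mpoly.span (mon ` {\<nu> \<in> ballot n 1 0. mdeg n \<nu> < d})"

lemma ballot_span_deg: "q \<in> ballot_span n d \<Longrightarrow> deg_lt n d q"
  unfolding ballot_span_def
proof (induction q rule: mpoly.span_induct_alt)
  case (step c x y)
  have "deg_lt n d x" using step.hyps by (auto simp: deg_lt_def)
  then show ?case using step by (intro deg_lt_add deg_lt_scale)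
qed simp

lemma ballot_span_mono: "d \<le> e \<Longrightarrow> ballot_span n d \<subseteq> ballot_span n e"
  unfolding ballot_span_def by (intro mpoly.span_mono) auto

lemma ballot_span_carrier: "ballot_span n d \<subseteq> mpoly_carrier n"
  unfolding ballot_span_def
  by (rule mpoly.span_minimal[OF _ carrier_subspace]) (auto simp: mon_carrier ballot_def)

lemma excess_products_qsym_ideal: "excess_products n 1 0 d \<subseteq> qsym_ideal n"
proof
  fix p assume "p \<in> excess_products n 1 0 d"
  then obtain \<mu> w where p: "p = mon \<mu> * fundamental [1..<Suc n] w" "Poly_Mapping.keys \<mu> \<subseteq> {1..n}" "w \<noteq> []"
    unfolding excess_products_def by blast
  interpret R: cring "mpoly_ring n" by (rule cring_mpoly_ring)
  have "qsym_plus n \<subseteq> qsym_ideal n"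
    unfolding qsym_ideal_def
    by (rule R.genideal_self) (simp add: mpoly_ring_simps qsym_plus_carrier)
  then have "fundamental [1..<Suc n] w \<in> qsym_ideal n"
    using fundamental_in_qsym_plus[OF p(3)] by blast
  then show "p \<in> qsym_ideal n"
    unfolding p(1) using p(2) by (intro ideal_mult_closed[OF ideal_qsym_ideal]) (auto simp: mon_carrier)
qed

text \<open>Straightening is homogeneous, so the representative obeys the same degree bound.\<close>

lemma ballot_span_mod_qsym_ideal:
  assumes "p \<in> mpoly_carrier n" "deg_lt n d p"
  shows "\<exists>q \<in> ballot_span n d. p - q \<in> qsym_ideal n"
proof -
  let ?B = "mon ` {\<nu> \<in> ballot n 1 0. mdeg n \<nu> < d}"
  have "mon m \<in> mpoly.span (?B \<union> qsym_ideal n)" if "m \<in> Poly_Mapping.keys p" for m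
  proof -
    have m: "Poly_Mapping.keys m \<subseteq> {1..n}" "mdeg n m < d"
      using assms that by (auto simp: mpoly_carrier_def deg_lt_def)
    have "mon m \<in> mpoly.span (mon ` {\<nu> \<in> ballot n 1 0. mdeg n \<nu> = mdeg n m} \<union> excess_products n 1 0 (mdeg n m))"
      using m by (intro mon_in_span_ballot) auto
    moreover have "mon ` {\<nu> \<in> ballot n 1 0. mdeg n \<nu> = mdeg n m} \<union> excess_products n 1 0 (mdeg n m)
        \<subseteq> ?B \<union> qsym_ideal n"
      using m(2) excess_products_qsym_ideal[of n "mdeg n m"] by auto
    ultimately show ?thesis using mpoly.span_mono by blast
  qed
  then have "mpoly.span (mon ` Poly_Mapping.keys p) \<subseteq> mpoly.span (?B \<union> qsym_ideal n)"
    by (intro mpoly.span_minimal) auto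
  then have "p \<in> mpoly.span (?B \<union> qsym_ideal n)" using in_span_mon_keys by blast
  then obtain q r where "p = q + r" "q \<in> ballot_span n d" "r \<in> mpoly.span (qsym_ideal n)"
    by (auto simp: mpoly.span_Un ballot_span_def)
  moreover have "mpoly.span (qsym_ideal n) = qsym_ideal n"
    using ideal_subspace[OF ideal_qsym_ideal] by simp
  ultimately show ?thesis by (intro bexI[of _ q]) auto
qed

section \<open>Leading forms\<close>

definition hom_component :: "nat \<Rightarrow> nat \<Rightarrow> mpoly \<Rightarrow> mpoly" where
  "hom_component n d p =
     (\<Sum>m \<in> {m \<in> Poly_Mapping.keys p. mdeg n m = d}. Poly_Mapping.single m (Poly_Mapping.lookup p m))"

lemma lookup_hom_component:
  "Poly_Mapping.lookup (hom_component n d p) m = (if mdeg n m = d then Poly_Mapping.lookup p m else 0)"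
  by (auto simp: hom_component_def lookup_sum lookup_single when_def in_keys_iff)

lemma hom_component_add: "hom_component n d (p + q) = hom_component n d p + hom_component n d q"
  by (rule poly_mapping_eqI) (simp add: lookup_hom_component lookup_add)

lemma lookup_scale: "Poly_Mapping.lookup (mpoly_scale c p) m = c * Poly_Mapping.lookup p m"
  unfolding mpoly_scale_def Const_def mult_map_scale_conv_mult[symmetric]
  by (simp add: map.rep_eq when_def)

lemma hom_component_scale: "hom_component n d (mpoly_scale c p) = mpoly_scale c (hom_component n d p)"
  by (rule poly_mapping_eqI) (simp add: lookup_hom_component lookup_scale)

lemma hom_component_0 [simp]: "hom_component n d 0 = 0"
  by (rule poly_mapping_eqI) (simp add: lookup_hom_component)

lemma hom_component_single:
  "hom_component n d (Poly_Mapping.single m c) = (if mdeg n m = d then Poly_Mapping.single m c else 0)"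
  by (rule poly_mapping_eqI) (auto simp: lookup_hom_component lookup_single when_def)

lemma hom_component_mon_mult:
  "hom_component n d (mon \<mu> * p) =
     (if mdeg n \<mu> \<le> d then mon \<mu> * hom_component n (d - mdeg n \<mu>) p else 0)"
proof (induction p rule: mpoly_induct)
  case (2 m c)
  then show ?case by (auto simp: mult_single hom_component_single mdeg_add)
next
  case (3 p q)
  then show ?case by (simp add: distrib_left hom_component_add)
qed simp

lemma hom_component_hom:
  assumes "p \<in> hom_polys n s e"
  shows "hom_component n d p = (if d = e then p else 0)"
  using hom_polys_keys(2)[OF assms]
  by (intro poly_mapping_eqI) (auto simp: lookup_hom_component in_keys_iff)

text \<open>The polynomials all of whose homogeneous components are leading forms (or zero) of members of \<open>I\<close>.\<close>

definition leading_forms :: "nat \<Rightarrow> mpoly set \<Rightarrow> mpoly set" where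
  "leading_forms n I = {p \<in> mpoly_carrier n. \<forall>d. \<exists>q \<in> I. deg_lt n d (q - hom_component n d p)}"

text \<open>When leading forms cancel in a sum, the component is zero and the sum of the chosen
  members has lower degree, as the definition allows.\<close>

lemma leading_forms_subspace:
  assumes "mpoly.subspace I"
  shows "mpoly.subspace (leading_forms n I)"
  unfolding mpoly.subspace_def
proof (intro conjI ballI allI)
  show "0 \<in> leading_forms n I"
    using mpoly.subspace_0[OF assms] by (auto simp: leading_forms_def mpoly_carrier_closed intro!: bexI[of _ 0])
next
  fix p q assume pq: "p \<in> leading_forms n I" "q \<in> leading_forms n I"
  have "\<exists>r\<in>I. deg_lt n d (r - hom_component n d (p + q))" for d
  proof -
    obtain p' where p': "p' \<in> I" "deg_lt n d (p' - hom_component n d p)"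
      using pq(1) unfolding leading_forms_def by blast
    obtain q' where q': "q' \<in> I" "deg_lt n d (q' - hom_component n d q)"
      using pq(2) unfolding leading_forms_def by blast
    show ?thesis
      using mpoly.subspace_add[OF assms p'(1) q'(1)] deg_lt_add[OF p'(2) q'(2)]
      by (intro bexI[of _ "p' + q'"]) (simp_all add: hom_component_add add_diff_add)
  qed
  then show "p + q \<in> leading_forms n I"
    using pq by (auto simp: leading_forms_def mpoly_carrier_closed)
next
  fix c p assume p: "p \<in> leading_forms n I"
  have "\<exists>r\<in>I. deg_lt n d (r - hom_component n d (mpoly_scale c p))" for d
  proof -
    obtain p' where "p' \<in> I" "deg_lt n d (p' - hom_component n d p)"
      using p by (auto simp: leading_forms_def)
    then show ?thesis
      using mpoly.subspace_scale[OF assms, of p' c] deg_lt_scale[of n d "p' - hom_component n d p" c]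
      by (intro bexI[of _ "mpoly_scale c p'"])
        (simp_all add: hom_component_scale mpoly.scale_right_diff_distrib)
  qed
  then show "mpoly_scale c p \<in> leading_forms n I"
    using p by (auto simp: leading_forms_def mpoly.subspace_scale[OF carrier_subspace])
qed

text \<open>By linearity a monomial factor suffices, and it only shifts the homogeneous
  components.\<close>

lemma leading_forms_mult:
  assumes I: "ideal I (mpoly_ring n)" and p: "p \<in> leading_forms n I" and r: "r \<in> mpoly_carrier n"
  shows "p * r \<in> leading_forms n I"
proof (rule mult_in_subspace[OF in_span_mon_keys])
  show "mpoly.subspace (leading_forms n I)" by (rule leading_forms_subspace[OF ideal_subspace[OF I]])
  fix s assume "s \<in> mon ` Poly_Mapping.keys r"
  then obtain \<mu> where s: "s = mon \<mu>" "Poly_Mapping.keys \<mu> \<subseteq> {1..n}"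
    using r by (auto simp: mpoly_carrier_def)
  then have sc: "s \<in> mpoly_carrier n" by (simp add: mon_carrier)
  have "\<exists>q\<in>I. deg_lt n d (q - hom_component n d (s * p))" for d
  proof (cases "mdeg n \<mu> \<le> d")
    case True
    obtain q where "q \<in> I" "deg_lt n (d - mdeg n \<mu>) (q - hom_component n (d - mdeg n \<mu>) p)"
      using p by (auto simp: leading_forms_def)
    then show ?thesis
      using deg_lt_single_mult[of n "d - mdeg n \<mu>" "q - hom_component n (d - mdeg n \<mu>) p" \<mu> 1]
        ideal_mult_closed[OF I _ sc] True s(1)
      by (intro bexI[of _ "s * q"]) (auto simp: hom_component_mon_mult right_diff_distrib)
  next
    case False
    then show ?thesis
      using mpoly.subspace_0[OF ideal_subspace[OF I]] s(1)
      by (intro bexI[of _ 0]) (auto simp: hom_component_mon_mult)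
  qed
  then show "p * s \<in> leading_forms n I"
    using p sc by (simp add: leading_forms_def mpoly_carrier_closed mult.commute)
qed

lemma leading_forms_ideal:
  assumes I: "ideal I (mpoly_ring n)"
  shows "ideal (leading_forms n I) (mpoly_ring n)"
proof -
  interpret R: cring "mpoly_ring n" by (rule cring_mpoly_ring)
  note L = leading_forms_subspace[OF ideal_subspace[OF I], of n]
  have sub: "leading_forms n I \<subseteq> mpoly_carrier n" by (auto simp: leading_forms_def)
  show ?thesis
  proof (rule idealI)
    show "ring (mpoly_ring n)" by unfold_locales
    show "subgroup (leading_forms n I) (add_monoid (mpoly_ring n))"
    proof (rule R.add.subgroupI)
      fix p assume p: "p \<in> leading_forms n I"
      then have "\<ominus>\<^bsub>mpoly_ring n\<^esub> p = - p"
        using sub by (intro R.minus_equality) (auto simp: mpoly_ring_simps mpoly_carrier_closed)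
      then show "\<ominus>\<^bsub>mpoly_ring n\<^esub> p \<in> leading_forms n I"
        using mpoly.subspace_neg[OF L p] by simp
    qed (use sub L mpoly.subspace_0[OF L] in \<open>auto simp: mpoly_ring_simps mpoly.subspace_add\<close>)
  qed (use leading_forms_mult[OF I] in \<open>auto simp: mpoly_ring_simps mult.commute\<close>)
qed

text \<open>Leading forms constitute an ideal, so generators suffice: M_\<alpha> is homogeneous and
  is the top part of \<open>vanishing_qs\<close>.\<close>

lemma qsym_ideal_leading_forms: "qsym_ideal n \<subseteq> leading_forms n (vanishing_ideal n (QSV n))"
proof -
  let ?I = "vanishing_ideal n (QSV n)"
  interpret R: cring "mpoly_ring n" by (rule cring_mpoly_ring)
  have I: "ideal ?I (mpoly_ring n)" by (rule ideal_vanishing_ideal)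
  note sub = leading_forms_subspace[OF ideal_subspace[OF I], of n]
  have "monomial_qsym n \<alpha> \<in> leading_forms n ?I" if \<alpha>: "composition \<alpha>" "\<alpha> \<noteq> []" for \<alpha>
  proof -
    have "\<exists>q\<in>?I. deg_lt n d (q - hom_component n d (monomial_qsym n \<alpha>))" for d
    proof -
      have hom: "hom_component n d (monomial_qsym n \<alpha>) = (if d = sum_list \<alpha> then monomial_qsym n \<alpha> else 0)"
        unfolding monomial_qsym_eq by (rule hom_component_hom[OF monomial_qs_hom, of _ 1]) auto
      show ?thesis
      proof (cases "d = sum_list \<alpha>")
        case True
        have "deg_lt n d (vanishing_qs [1..<Suc n] \<alpha> - monomial_qsym n \<alpha>)"
          unfolding True monomial_qsym_eq by (rule vanishing_qs_leading) (use \<alpha> in auto)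
        then show ?thesis
          using vanishing_qs_in_vanishing_ideal[OF \<alpha>(2), of n] hom True
          by (intro bexI[of _ "vanishing_qs [1..<Suc n] \<alpha>"]) auto
      next
        case False
        then show ?thesis
          using hom mpoly.subspace_0[OF ideal_subspace[OF I]] by (intro bexI[of _ 0]) auto
      qed
    qed
    then show ?thesis by (simp add: leading_forms_def monomial_qsym_carrier)
  qed
  then have "qsym_plus n \<subseteq> leading_forms n ?I"
    unfolding qsym_plus_def by (intro mpoly.span_minimal sub) auto
  then show ?thesis
    unfolding qsym_ideal_def by (intro R.genideal_minimal leading_forms_ideal I)
qed

text \<open>Both \<open>p\<close> and a vanishing polynomial with its degree \<open>d\<close>
  component as leading form differ from that component in lower degree only.\<close>

lemma qsym_ideal_lift:
  assumes "p \<in> qsym_ideal n" "deg_lt n (Suc d) p"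
  shows "\<exists>q \<in> vanishing_ideal n (QSV n). deg_lt n d (p - q)"
proof -
  obtain q where q: "q \<in> vanishing_ideal n (QSV n)" "deg_lt n d (q - hom_component n d p)"
    using assms(1) qsym_ideal_leading_forms by (force simp: leading_forms_def)
  have "deg_lt n d (p - hom_component n d p)"
    using assms(2) by (auto simp: deg_lt_def in_keys_iff lookup_minus lookup_hom_component less_Suc_eq split: if_splits)
  from deg_lt_diff[OF this q(2)] show ?thesis using q(1) by auto
qed

text \<open>Induction on the degree bound: straighten modulo \<open>qsym_ideal\<close>, trade the
  remainder for a vanishing polynomial, and recurse on the error of lower degree.\<close>

lemma ballot_span_mod_vanishing_ideal:
  assumes "p \<in> mpoly_carrier n" "deg_lt n d p"
  shows "\<exists>q \<in> ballot_span n d. p - q \<in> vanishing_ideal n (QSV n)"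
  using assms
proof (induction d arbitrary: p)
  case 0
  then show ?case
    using mpoly.subspace_0[OF ideal_subspace[OF ideal_vanishing_ideal]]
    by (intro bexI[of _ 0]) (auto simp: deg_lt_0_iff ballot_span_def mpoly.span_zero)
next
  case (Suc d)
  note I = ideal_vanishing_ideal[of n "QSV n"]
  obtain q where q: "q \<in> ballot_span n (Suc d)" "p - q \<in> qsym_ideal n"
    using ballot_span_mod_qsym_ideal Suc.prems by blast
  then have "deg_lt n (Suc d) (p - q)" using ballot_span_deg Suc.prems(2) by (intro deg_lt_diff) auto
  then obtain r where r: "r \<in> vanishing_ideal n (QSV n)" "deg_lt n d (p - q - r)"
    using qsym_ideal_lift q(2) by blast
  have "p - q - r \<in> mpoly_carrier n"
    using ideal_subset_carrier[OF I] r(1) Suc.prems(1) q(1) ballot_span_carrier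
    by (intro mpoly_carrier_diff) auto
  then obtain q' where q': "q' \<in> ballot_span n d" "p - q - r - q' \<in> vanishing_ideal n (QSV n)"
    using Suc.IH r(2) by blast
  have "(p - q - r - q') + r = p - (q + q')" by simp
  then have "p - (q + q') \<in> vanishing_ideal n (QSV n)"
    using mpoly.subspace_add[OF ideal_subspace[OF I] q'(2) r(1)] by (simp only:)
  moreover have "q + q' \<in> ballot_span n (Suc d)"
    using q(1) q'(1) ballot_span_mono[of d "Suc d" n]
    by (auto simp: ballot_span_def intro: mpoly.span_add)
  ultimately show ?case by blast
qed

section \<open>The ballot space as a common complement\<close>

definition ballot_space :: "nat \<Rightarrow> mpoly set" where
  "ballot_space n = mpoly.span (mon ` ballot n 1 0)"

lemma ballot_span_subset: "ballot_span n d \<subseteq> ballot_space n"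
  unfolding ballot_span_def ballot_space_def by (intro mpoly.span_mono) auto

lemma ex_deg_lt: "\<exists>d. deg_lt n d p"
proof -
  have "\<forall>m \<in> Poly_Mapping.keys p. mdeg n m < Suc (Max (mdeg n ` Poly_Mapping.keys p))"
    by (auto simp: less_Suc_eq_le)
  then show ?thesis by (auto simp: deg_lt_def)
qed

text \<open>The stack construction injects ballot monomials into noncrossing partitions, which are
  counted by \<open>QSV n\<close>.\<close>

lemma card_ballot: "finite (ballot n 1 0) \<and> card (ballot n 1 0) \<le> card (QSV n)"
proof -
  let ?f = "\<lambda>\<nu>. stack_arcs n (Poly_Mapping.lookup \<nu>)"
  have b: "(\<Sum>j=1..i. Poly_Mapping.lookup \<nu> j) < i" if "\<nu> \<in> ballot n 1 0" "i \<in> {1..n}" for \<nu> i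
    using that by (simp add: ballot_def)
  have inj: "inj_on ?f (ballot n 1 0)"
  proof (rule inj_onI)
    fix \<nu> \<nu>' assume \<nu>: "\<nu> \<in> ballot n 1 0" "\<nu>' \<in> ballot n 1 0" and eq: "?f \<nu> = ?f \<nu>'"
    show "\<nu> = \<nu>'"
    proof (rule poly_mapping_eqI)
      fix k
      show "Poly_Mapping.lookup \<nu> k = Poly_Mapping.lookup \<nu>' k"
      proof (cases "k \<in> {1..n}")
        case True
        then show ?thesis using stack_arcs_inj[OF b[OF \<nu>(1)] b[OF \<nu>(2)] eq] by simp
      next
        case False
        then have "k \<notin> Poly_Mapping.keys \<nu>" "k \<notin> Poly_Mapping.keys \<nu>'"
          using \<nu> by (auto simp: ballot_def)
        then show ?thesis by (simp add: in_keys_iff)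
      qed
    qed
  qed
  have sub: "?f ` ballot n 1 0 \<subseteq> {A. noncrossing_partition n A}"
    using noncrossing_stack_arcs b by auto
  show ?thesis
    unfolding card_QSV
    using inj_on_finite[OF inj sub finite_noncrossing] card_inj_on_le[OF inj sub finite_noncrossing]
    by blast
qed

text \<open>For each other point take a coordinate where it differs from \<open>\<sigma>\<close> and
  multiply the linear factors; such a coordinate lies in \<open>{1..n}\<close>, all these
  permutations being the identity elsewhere.\<close>

lemma separating_polynomial:
  assumes "\<sigma> \<in> QSV n"
  shows "\<exists>p \<in> mpoly_carrier n. mpoly_eval p (\<lambda>i. of_nat (\<sigma> i)) \<noteq> 0 \<and>
    (\<forall>\<tau> \<in> QSV n - {\<sigma>}. mpoly_eval p (\<lambda>i. of_nat (\<tau> i)) = 0)"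
proof -
  have "\<exists>i \<in> {1..n}. \<tau> i \<noteq> \<sigma> i" if \<tau>: "\<tau> \<in> QSV n" "\<tau> \<noteq> \<sigma>" for \<tau>
  proof -
    obtain i where i: "\<tau> i \<noteq> \<sigma> i" using \<tau>(2) by auto
    have "\<tau> i = i" "\<sigma> i = i" if "i \<notin> {1..n}" using \<tau>(1) assms that by (auto simp: QSV_def Q_perm_def)
    with i show ?thesis by metis
  qed
  then obtain k where k: "\<And>\<tau>. \<tau> \<in> QSV n - {\<sigma>} \<Longrightarrow> k \<tau> \<in> {1..n} \<and> \<tau> (k \<tau>) \<noteq> \<sigma> (k \<tau>)"
    by (metis Diff_iff singletonI)
  define p where "p = (\<lambda>T. \<Prod>\<tau>\<in>T. Var (k \<tau>) - Const (of_nat (\<tau> (k \<tau>))))"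
  have eval: "mpoly_eval (p T) v = (\<Prod>\<tau>\<in>T. v (k \<tau>) - of_nat (\<tau> (k \<tau>)))" if "finite T" for T v
    using that by (induction T) (simp_all add: p_def mpoly_eval_mult mpoly_eval_diff)
  have "p T \<in> mpoly_carrier n" if "finite T" "T \<subseteq> QSV n - {\<sigma>}" for T
    using that
  proof (induction T)
    case (insert \<tau> T)
    then show ?case using k[of \<tau>] by (auto simp: p_def mpoly_carrier_closed mpoly_carrier_diff)
  qed (simp add: p_def mpoly_carrier_closed)
  moreover have fin: "finite (QSV n - {\<sigma>})" using finite_QSV by simp
  moreover have "mpoly_eval (p (QSV n - {\<sigma>})) (\<lambda>i. of_nat (\<sigma> i)) \<noteq> 0"
    unfolding eval[OF fin] prod_zero_iff[OF fin] using k by (metis eq_iff_diff_eq_0 of_nat_eq_iff)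
  moreover have "mpoly_eval (p (QSV n - {\<sigma>})) (\<lambda>i. of_nat (\<tau> i)) = 0" if "\<tau> \<in> QSV n - {\<sigma>}" for \<tau>
    unfolding eval[OF fin]
    by (rule prod_zero) (use that finite_QSV in auto)
  ultimately show ?thesis by blast
qed

text \<open>Evaluation maps the ballot space onto all functions on \<open>QSV n\<close>, and the
  dimension of the space is at most their number of points, so the map is injective.\<close>

lemma ballot_space_inter_vanishing_ideal:
  assumes p: "p \<in> ballot_space n" "p \<in> vanishing_ideal n (QSV n)"
  shows "p = 0"
proof -
  let ?e = "\<lambda>q \<sigma>. mpoly_eval q (\<lambda>i. of_nat (\<sigma> i :: nat))"
  \<comment> \<open>Reducing a separating polynomial modulo the vanishing ideal keeps its
    values.\<close>
  have "\<exists>w \<in> ballot_space n. ?e w \<sigma> \<noteq> 0 \<and> (\<forall>\<tau> \<in> QSV n - {\<sigma>}. ?e w \<tau> = 0)"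
    if \<sigma>: "\<sigma> \<in> QSV n" for \<sigma>
  proof -
    obtain q where q: "q \<in> mpoly_carrier n" "?e q \<sigma> \<noteq> 0" "\<forall>\<tau> \<in> QSV n - {\<sigma>}. ?e q \<tau> = 0"
      using separating_polynomial[OF \<sigma>] by blast
    obtain d where "deg_lt n d q" using ex_deg_lt by blast
    then obtain w where w: "w \<in> ballot_space n" "q - w \<in> vanishing_ideal n (QSV n)"
      using ballot_span_mod_vanishing_ideal q(1) ballot_span_subset by blast
    then have "?e w \<tau> = ?e q \<tau>" if "\<tau> \<in> QSV n" for \<tau>
      using that by (auto simp: vanishing_ideal_def mpoly_eval_diff)
    then show ?thesis using q \<sigma> w(1) by (intro bexI[of _ w]) auto
  qed
  then obtain w where w: "\<And>\<sigma>. \<sigma> \<in> QSV n \<Longrightarrow> w \<sigma> \<in> ballot_space n \<and> ?e (w \<sigma>) \<sigma> \<noteq> 0 \<and>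
      (\<forall>\<tau> \<in> QSV n - {\<sigma>}. ?e (w \<sigma>) \<tau> = 0)"
    by metis
  have e_sum: "?e (\<Sum>\<sigma>\<in>T. mpoly_scale (c \<sigma>) (w \<sigma>)) \<tau> = c \<tau> * ?e (w \<tau>) \<tau>"
    if "T = QSV n" "\<tau> \<in> QSV n" for c \<tau> T
  proof -
    have "?e (\<Sum>\<sigma>\<in>T. mpoly_scale (c \<sigma>) (w \<sigma>)) \<tau> = (\<Sum>\<sigma>\<in>T. c \<sigma> * ?e (w \<sigma>) \<tau>)" for T
      by (induction T rule: infinite_finite_induct)
        (simp_all add: mpoly_eval_add mpoly_scale_def mpoly_eval_mult)
    also have "(\<Sum>\<sigma>\<in>QSV n. c \<sigma> * ?e (w \<sigma>) \<tau>) = (\<Sum>\<sigma>\<in>{\<tau>}. c \<sigma> * ?e (w \<sigma>) \<tau>)"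
      using w that finite_QSV by (intro sum.mono_neutral_right) auto
    finally show ?thesis using that by simp
  qed
  have inj: "inj_on w (QSV n)"
    by (rule inj_onI) (metis w Diff_iff singletonD)
  have combination: "\<exists>c. q = (\<Sum>\<sigma>\<in>QSV n. mpoly_scale (c \<sigma>) (w \<sigma>))"
    if "q \<in> mpoly.span (w ` QSV n)" for q
    using that
    by (auto simp: mpoly.span_finite finite_QSV sum.reindex[OF inj])
  have "mpoly.independent (w ` QSV n)"
  proof (rule mpoly.independent_if_scalars_zero)
    fix f x assume 0: "(\<Sum>x\<in>w ` QSV n. mpoly_scale (f x) x) = 0" and "x \<in> w ` QSV n"
    then obtain \<sigma> where \<sigma>: "\<sigma> \<in> QSV n" "x = w \<sigma>" by auto
    have "f (w \<sigma>) * ?e (w \<sigma>) \<sigma> = ?e 0 \<sigma>"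
      using e_sum[OF refl \<sigma>(1), of "\<lambda>\<sigma>. f (w \<sigma>)"] 0 by (simp add: sum.reindex[OF inj])
    then show "f x = 0" using w[OF \<sigma>(1)] \<sigma>(2) by simp
  qed (simp add: finite_QSV)
  moreover have sub: "w ` QSV n \<subseteq> ballot_space n" using w by auto
  moreover have "p \<in> mpoly.span (w ` QSV n)"
  proof (rule ccontr)
    assume np: "p \<notin> mpoly.span (w ` QSV n)"
    \<comment> \<open>Otherwise there would be more independent elements than ballot monomials
      spanning the space.\<close>
    then have "mpoly.independent (insert p (w ` QSV n))"
      using calculation(1) by (rule mpoly.independent_insertI)
    moreover have "finite (mon ` ballot n 1 0)" using card_ballot by simp
    ultimately have "card (insert p (w ` QSV n)) \<le> card (mon ` ballot n 1 0)"
      using sub p(1) mpoly.independent_span_bound unfolding ballot_space_def by (metis insert_subset)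
    also have "\<dots> \<le> card (ballot n 1 0)" using card_ballot by (intro card_image_le) auto
    also have "\<dots> \<le> card (QSV n)" using card_ballot by auto
    moreover have "p \<notin> w ` QSV n" using np mpoly.span_base by blast
    ultimately show False
      using finite_QSV[of n] card_image[OF inj] by simp
  qed
  then obtain c where c: "p = (\<Sum>\<sigma>\<in>QSV n. mpoly_scale (c \<sigma>) (w \<sigma>))" using combination by blast
  have "c \<sigma> = 0" if "\<sigma> \<in> QSV n" for \<sigma>
    using e_sum[OF refl that, of c] p(2) w[OF that] that c by (auto simp: vanishing_ideal_def)
  then show ?thesis unfolding c by simp
qed

text \<open>Lower the degree bound step by step: \<open>p\<close> agrees modulo the vanishing ideal
  with an element \<open>w\<close> of the ballot space of smaller degree, and independence there
  forces \<open>p = w\<close>.\<close>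

lemma ballot_space_inter_qsym_ideal:
  assumes p: "p \<in> ballot_space n" "p \<in> qsym_ideal n"
  shows "p = 0"
proof -
  have "p = 0" if "deg_lt n d p" for d
    using that
  proof (induction d)
    case (Suc d)
    note I = ideal_vanishing_ideal[of n "QSV n"]
    obtain q where q: "q \<in> vanishing_ideal n (QSV n)" "deg_lt n d (p - q)"
      using qsym_ideal_lift[OF p(2) Suc.prems] by blast
    have "p - q \<in> mpoly_carrier n"
      using ideal_subset_carrier[OF I] ideal_subset_carrier[OF ideal_qsym_ideal] q(1) p(2)
      by (intro mpoly_carrier_diff) auto
    then obtain w where w: "w \<in> ballot_span n d" "p - q - w \<in> vanishing_ideal n (QSV n)"
      using ballot_span_mod_vanishing_ideal q(2) by blast
    have "(p - q - w) + q = p - w" by simp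
    then have "p - w \<in> vanishing_ideal n (QSV n)"
      using mpoly.subspace_add[OF ideal_subspace[OF I] w(2) q(1)] by (simp only:)
    moreover have "p - w \<in> ballot_space n"
      using p(1) w(1) ballot_span_subset mpoly.span_diff unfolding ballot_space_def by blast
    ultimately have "p - w = 0" using ballot_space_inter_vanishing_ideal by blast
    then show ?case using Suc.IH ballot_span_deg[OF w(1)] by simp
  qed (simp add: deg_lt_0_iff)
  then show ?thesis using ex_deg_lt by blast
qed

section \<open>Quotients with a common complement\<close>

lemma quotient_space_carrier: "carrier (quotient_space n I) = (\<lambda>p. I +>\<^bsub>mpoly_ring n\<^esub> p) ` mpoly_carrier n"
  by (auto simp: quotient_space_simps A_RCOSETS_def' mpoly_ring_simps)

lemma coset_eq_iff:
  assumes I: "ideal I (mpoly_ring n)" and "p \<in> mpoly_carrier n" "q \<in> mpoly_carrier n"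
  shows "I +>\<^bsub>mpoly_ring n\<^esub> p = I +>\<^bsub>mpoly_ring n\<^esub> q \<longleftrightarrow> p - q \<in> I"
proof -
  interpret R: cring "mpoly_ring n" by (rule cring_mpoly_ring)
  have "\<ominus>\<^bsub>mpoly_ring n\<^esub> q = - q"
    using assms(3) by (intro R.minus_equality) (auto simp: mpoly_ring_simps mpoly_carrier_closed)
  then show ?thesis
    using R.quotient_eq_iff_same_a_r_cos[OF I, of p q] assms(2,3)
    by (simp add: mpoly_ring_simps a_minus_def)
qed

text \<open>The complement \<open>W\<close> maps bijectively and linearly onto each quotient; the
  isomorphism takes the representative in \<open>W\<close> of one coset to its coset in the
  other.\<close>

lemma module_iso_common_complement:
  assumes I: "ideal I (mpoly_ring n)" and J: "ideal J (mpoly_ring n)"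
    and W: "mpoly.subspace W" "W \<subseteq> mpoly_carrier n"
    and complement: "\<And>p. p \<in> mpoly_carrier n \<Longrightarrow> \<exists>w \<in> W. p - w \<in> I" "W \<inter> I \<subseteq> {0}"
      "\<And>p. p \<in> mpoly_carrier n \<Longrightarrow> \<exists>w \<in> W. p - w \<in> J" "W \<inter> J \<subseteq> {0}"
  shows "module_iso rat_ring (quotient_space n I) (quotient_space n J) \<noteq> {}"
proof -
  have bij: "bij_betw (\<lambda>w. K +>\<^bsub>mpoly_ring n\<^esub> w) W (carrier (quotient_space n K))"
    if K: "ideal K (mpoly_ring n)" "\<And>p. p \<in> mpoly_carrier n \<Longrightarrow> \<exists>w \<in> W. p - w \<in> K" "W \<inter> K \<subseteq> {0}" for K
  proof (rule bij_betwI')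
    fix u v assume uv: "u \<in> W" "v \<in> W"
    have "K +>\<^bsub>mpoly_ring n\<^esub> u = K +>\<^bsub>mpoly_ring n\<^esub> v \<longleftrightarrow> u - v \<in> K"
      using uv W(2) by (intro coset_eq_iff K) auto
    also have "\<dots> \<longleftrightarrow> u = v"
      using mpoly.subspace_diff[OF W(1) uv] K(3) mpoly.subspace_0[OF ideal_subspace[OF K(1)]] by auto
    finally show "K +>\<^bsub>mpoly_ring n\<^esub> u = K +>\<^bsub>mpoly_ring n\<^esub> v \<longleftrightarrow> u = v" .
  next
    fix u assume "u \<in> W"
    then show "K +>\<^bsub>mpoly_ring n\<^esub> u \<in> carrier (quotient_space n K)"
      using W(2) by (auto simp: quotient_space_carrier)
  next
    fix C assume "C \<in> carrier (quotient_space n K)"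
    then obtain p where p: "p \<in> mpoly_carrier n" "C = K +>\<^bsub>mpoly_ring n\<^esub> p"
      by (auto simp: quotient_space_carrier)
    with K(2) obtain w where "w \<in> W" "p - w \<in> K" by blast
    then show "\<exists>w\<in>W. C = K +>\<^bsub>mpoly_ring n\<^esub> w"
      using coset_eq_iff[OF K(1) p(1)] p(2) W(2) by auto
  qed
  define s where "s = the_inv_into W (\<lambda>w. I +>\<^bsub>mpoly_ring n\<^esub> w)"
  define f where "f = (\<lambda>C. J +>\<^bsub>mpoly_ring n\<^esub> s C)"
  note bI = bij[OF I complement(1,2)] and bJ = bij[OF J complement(3,4)]
  have s: "s (I +>\<^bsub>mpoly_ring n\<^esub> w) = w" if "w \<in> W" for w
    unfolding s_def using that bij_betw_imp_inj_on[OF bI] by (simp add: the_inv_into_f_f)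
  have rep: "\<exists>w\<in>W. C = I +>\<^bsub>mpoly_ring n\<^esub> w" if "C \<in> carrier (quotient_space n I)" for C
    using that bij_betw_imp_surj_on[OF bI] by auto
  have add: "(K +>\<^bsub>mpoly_ring n\<^esub> u) \<oplus>\<^bsub>quotient_space n K\<^esub> (K +>\<^bsub>mpoly_ring n\<^esub> v) = K +>\<^bsub>mpoly_ring n\<^esub> (u + v)"
    if K: "ideal K (mpoly_ring n)" "u \<in> W" "v \<in> W" for K u v
  proof -
    interpret K: ideal K "mpoly_ring n" by (rule K)
    show ?thesis
      using K.a_rcos_sum[of u v] K(2,3) W(2) by (auto simp: quotient_space_simps FactRing_def mpoly_ring_simps)
  qed
  have "f \<in> module_iso rat_ring (quotient_space n I) (quotient_space n J)"
    unfolding module_iso_def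
  proof (intro CollectI conjI ballI)
    have "bij_betw s (carrier (quotient_space n I)) W"
      unfolding s_def using bI by (rule bij_betw_the_inv_into)
    from bij_betw_trans[OF this bJ] show "bij_betw f (carrier (quotient_space n I)) (carrier (quotient_space n J))"
      by (simp add: f_def comp_def)
  next
    fix x y assume "x \<in> carrier (quotient_space n I)" "y \<in> carrier (quotient_space n I)"
    then obtain u v where "u \<in> W" "v \<in> W" "x = I +>\<^bsub>mpoly_ring n\<^esub> u" "y = I +>\<^bsub>mpoly_ring n\<^esub> v"
      using rep by metis
    then show "f (x \<oplus>\<^bsub>quotient_space n I\<^esub> y) = f x \<oplus>\<^bsub>quotient_space n J\<^esub> f y"
      by (simp add: add I J f_def s mpoly.subspace_add[OF W(1)])
  next
    fix c x assume "x \<in> carrier (quotient_space n I)"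
    then obtain u where u: "u \<in> W" "x = I +>\<^bsub>mpoly_ring n\<^esub> u" using rep by metis
    then have "u \<in> carrier (mpoly_ring n)" using W(2) by (auto simp: mpoly_ring_simps)
    then show "f (c \<odot>\<^bsub>quotient_space n I\<^esub> x) = c \<odot>\<^bsub>quotient_space n J\<^esub> f x"
      using u by (simp add: quotient_space_smult I J f_def s mpoly.subspace_scale[OF W(1)])
  qed
  then show ?thesis by blast
qed

theorem corollary6p4:
  fixes n :: nat
  shows "module_iso rat_ring (quotient_space n (qsym_ideal n))
           (quotient_space n (vanishing_ideal n (QSV n))) \<noteq> {}"
proof (rule module_iso_common_complement[OF ideal_qsym_ideal ideal_vanishing_ideal])
  show "mpoly.subspace (ballot_space n)" by (simp add: ballot_space_def)
  show "ballot_space n \<subseteq> mpoly_carrier n"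
    unfolding ballot_space_def
    by (rule mpoly.span_minimal[OF _ carrier_subspace]) (auto simp: mon_carrier ballot_def)
  show "ballot_space n \<inter> qsym_ideal n \<subseteq> {0}" "ballot_space n \<inter> vanishing_ideal n (QSV n) \<subseteq> {0}"
    using ballot_space_inter_qsym_ideal ballot_space_inter_vanishing_ideal by auto
  fix p assume p: "p \<in> mpoly_carrier n"
  obtain d where d: "deg_lt n d p" using ex_deg_lt by blast
  show "\<exists>w \<in> ballot_space n. p - w \<in> qsym_ideal n"
    using ballot_span_mod_qsym_ideal[OF p d] ballot_span_subset by blast
  show "\<exists>w \<in> ballot_space n. p - w \<in> vanishing_ideal n (QSV n)"
    using ballot_span_mod_vanishing_ideal[OF p d] ballot_span_subset by blast
qed

end
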